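(* Let $n$ and $k$ be integers with $6\le k\le n+1$, and let $d\in\mathbb{Z}$. Then the Manturov–Nikonov map $$\rho\circ f_d\circ p_k:\ PB_{n+1}\longrightarrow GL_n(\mathbb{Z}[t^{\pm1},s^{\pm1}])$$ is not faithful, i.e. its kernel contains a non-trivial element of $PB_{n+1}$.
   Context: $B_{n+1}$ is the Artin braid group with standard generators $\sigma_1,\dots,\sigma_n$, and $PB_{n+1}\subset B_{n+1}$ is the pure braid group. **Cylindrical groups.** $CB_n$ is the group of braids on $n$ strands in the cylinder. It is generated by $\sigma_1,\dots,\sigma_{n-1}$ and the cyclic rotation $\zeta$, subject to the braid relations among the $\sigma_i$, the relations $\zeta\sigma_{i+1}\zeta^{-1}=\sigma_i$ ($1\le i\le n-2$), and $\zeta^2\sigma_1\zeta^{-2}=\sigma_{n-1}$. $CPB_n\subset CB_n$ is the subgroup of pure cylindrical braids. $VCB_n$ is the group of virtual braids on $n$ strands in the cylinder. It is generated by $\sigma_1,\dots,\sigma_{n-1}$, virtual crossings $\tau_1,\dots,\tau_{n-1}$, and $\zeta$, subject to: - the relations above; - the relations of the symmetric group for the $\tau_i$: $\tau_i^2=1$, $\tau_i\tau_{i+1}\tau_i=\tau_{i+1}\tau_i\tau_{i+1}$, $\tau_i\tau_j=\tau_j\tau_i$ for $|i-j|\ge2$; - the mixed relations $\sigma_i\tau_j=\tau_j\sigma_i$ for $|i-j|\ge 2$ and $\tau_i\tau_{i+1}\sigma_i=\sigma_{i+1}\tau_i\tau_{i+1}$; - $\zeta\tau_{i+1}\zeta^{-1}=\tau_i$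 ($1\le i\le n-2$) and $\zeta^2\tau_1\zeta^{-2}=\tau_{n-1}$. **The map $p_k: PB_{n+1}\to CPB_n$** ($1\le k\le n+1$). Geometrically, a pure braid with strands $\beta_1,\dots,\beta_{n+1}:[0,1]\to\mathbb{C}$ is sent to the cylindrical braid with strands $\frac{\beta_l(t)-\beta_k(t)}{|\beta_l(t)-\beta_k(t)|}\in\mathbb{S}^1$, $l\ne k$. Algebraically, write the pure braid as a word in the letters $\sigma_i^{\epsilon}$, $\epsilon=\pm1$, read from left to right, and let $c$ be the current position of the strand that starts in position $k$ (so initially $c=k$). Each letter $\sigma_i^\epsilon$ is replaced by - $\sigma_{c-i-1}^{\epsilon}$ if $i<c-1$, and $\sigma_{n+c-i}^{\epsilon}$ if $i>c$ (that is, the index $c-i-1$ is taken modulo $n+1$); - $\zeta^{-1}$ if $i=c-1$, $\epsilon=1$; - $\Delta_c$ if $i=c-1$, $\epsilon=-1$; - $\Delta_c^{-1}$ if $i=c$, $\epsilon=1$; - $\zeta$ if $i=c$, $\epsilon=-1$. Here $\Delta_c=\sigma_1\cdots\sigma_{n-1}$ (the subscript in this symbol is only part of the name). After the letter, $c$ is updated to $c-1$ if $i=c-1$, to $c+1$ if $i=c$, and is unchanged otherwise. The image $p_k(\beta)$ is the product of the replaced letters in the same order. **The map $f_d: CPB_n\to VCB_n$.** It is the restriction to $CPB_n$ of the homomorphism $CB_n\to VCB_n$ given by $\sigma_i\mapsto\sigma_i$, $\zeta\mapsto\zeta(\Delta_v\zeta)^{d-1}$, where $\Delta_v=\tau_1\cdots\tau_{n-1}$.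 (Geometrically, it is induced by $z\mapsto z^d$.) **The map $\rho: VCB_n\to GL_n(\mathbb{Z}[t^{\pm1},s^{\pm1}])$.** It is the homomorphism $$\sigma_j\mapsto I_{j-1}\oplus\begin{pmatrix}1-t&t\\ 1&0\end{pmatrix}\oplus I_{n-j-1},\quad \tau_j\mapsto I_{j-1}\oplus\begin{pmatrix}0&s\\ s^{-1}&0\end{pmatrix}\oplus I_{n-j-1},\quad \zeta\mapsto\begin{pmatrix}\mathbf{0}&I_{n-1}\\ 1&\mathbf{0}\end{pmatrix}.$$ *)

theory Defs
  imports
    "Jordan_Normal_Form.Matrix"
    "HOL-Algebra.Sym_Groups"
    "HOL-Library.Poly_Mapping"
    "HOL-Library.Product_Plus"
begin

section \<open>Groups given by generators and relations\<close>

text \<open>The letter \<open>(x, True)\<close> stands for the generator \<open>x\<close> and \<open>(x, False)\<close> for its inverse. A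
  relation \<open>r = r'\<close> is given as the pair \<open>(r, r')\<close>.\<close>

type_synonym 'x word = "('x \<times> bool) list"

definition words :: "'x set \<Rightarrow> 'x word set" where
  "words X = lists (X \<times> UNIV)"

definition word_inv :: "'x word \<Rightarrow> 'x word" where
  "word_inv w = rev (map (\<lambda>(x, e). (x, \<not> e)) w)"

inductive_set pres_rel :: "'x set \<Rightarrow> ('x word \<times> 'x word) set \<Rightarrow> ('x word \<times> 'x word) set"
  for X :: "'x set" and R :: "('x word \<times> 'x word) set" where
  refl: "w \<in> words X \<Longrightarrow> (w, w) \<in> pres_rel X R"
| sym: "(v, w) \<in> pres_rel X R \<Longrightarrow> (w, v) \<in> pres_rel X R"
| trans: "(u, v) \<in> pres_rel X R \<Longrightarrow> (v, w) \<in> pres_rel X R \<Longrightarrow> (u, w) \<in> pres_rel X R"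
| cancel: "u \<in> words X \<Longrightarrow> v \<in> words X \<Longrightarrow> x \<in> X \<Longrightarrow>
    (u @ [(x, e), (x, \<not> e)] @ v, u @ v) \<in> pres_rel X R"
| relation: "u \<in> words X \<Longrightarrow> v \<in> words X \<Longrightarrow> (r, r') \<in> R \<Longrightarrow> r \<in> words X \<Longrightarrow> r' \<in> words X \<Longrightarrow>
    (u @ r @ v, u @ r' @ v) \<in> pres_rel X R"

definition word_class :: "'x set \<Rightarrow> ('x word \<times> 'x word) set \<Rightarrow> 'x word \<Rightarrow> 'x word set" where
  "word_class X R w = pres_rel X R `` {w}"

definition pres_group :: "'x set \<Rightarrow> ('x word \<times> 'x word) set \<Rightarrow> 'x word set monoid" where
  "pres_group X R =
    \<lparr>carrier = words X // pres_rel X R,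
     mult = (\<lambda>A B. \<Union>a\<in>A. \<Union>b\<in>B. word_class X R (a @ b)),
     one = word_class X R []\<rparr>"

definition word_eval :: "('a, 'b) monoid_scheme \<Rightarrow> ('x \<Rightarrow> 'a) \<Rightarrow> 'x word \<Rightarrow> 'a" where
  "word_eval H f w =
    foldr (\<lambda>(x, e) a. (if e then f x else inv\<^bsub>H\<^esub> f x) \<otimes>\<^bsub>H\<^esub> a) w \<one>\<^bsub>H\<^esub>"

text \<open>The homomorphism from a presented group to \<open>H\<close> that extends the assignment \<open>f\<close> of the
  generators; see \<open>pres_lift_hom\<close> below.\<close>

definition pres_lift :: "('a, 'b) monoid_scheme \<Rightarrow> ('x \<Rightarrow> 'a) \<Rightarrow> 'x word set \<Rightarrow> 'a" where
  "pres_lift H f A = the_elem (word_eval H f ` A)"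

lemma Nil_words [simp]: "[] \<in> words X"
  by (simp add: words_def)

lemma Cons_words [simp]: "a # w \<in> words X \<longleftrightarrow> fst a \<in> X \<and> w \<in> words X"
  by (cases a) (simp add: words_def)

lemma append_words [simp]: "v @ w \<in> words X \<longleftrightarrow> v \<in> words X \<and> w \<in> words X"
  by (induction v) auto

lemma pres_rel_words: "(v, w) \<in> pres_rel X R \<Longrightarrow> v \<in> words X \<and> w \<in> words X"
  by (induction rule: pres_rel.induct) auto

lemma equiv_pres_rel: "equiv (words X) (pres_rel X R)"
proof (rule equivI)
  show "pres_rel X R \<subseteq> words X \<times> words X" using pres_rel_words by fast
  show "refl_on (words X) (pres_rel X R)"
    by (auto simp: refl_on_def intro: pres_rel.refl)
  show "sym (pres_rel X R)" by (auto intro: symI pres_rel.sym)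
  show "trans (pres_rel X R)" by (auto intro: transI pres_rel.trans)
qed

lemma pres_rel_append_right:
  assumes "(v, w) \<in> pres_rel X R" "u \<in> words X"
  shows "(v @ u, w @ u) \<in> pres_rel X R"
  using assms
proof (induction rule: pres_rel.induct)
  case (cancel a b x e)
  then show ?case using pres_rel.cancel[of a X "b @ u" x e R] by simp
next
  case (relation a b r r')
  then show ?case using pres_rel.relation[of a X "b @ u" r r' R] by simp
qed (auto intro: pres_rel.refl pres_rel.sym pres_rel.trans)

lemma pres_rel_append_left:
  assumes "(v, w) \<in> pres_rel X R" "u \<in> words X"
  shows "(u @ v, u @ w) \<in> pres_rel X R"
  using assms
proof (induction rule: pres_rel.induct)
  case (cancel a b x e)
  then show ?case using pres_rel.cancel[of "u @ a" X b x e R] by simp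
next
  case (relation a b r r')
  then show ?case using pres_rel.relation[of "u @ a" X b r r' R] by simp
qed (auto intro: pres_rel.refl pres_rel.sym pres_rel.trans)

lemma pres_rel_append:
  "(v, w) \<in> pres_rel X R \<Longrightarrow> (v', w') \<in> pres_rel X R \<Longrightarrow> (v @ v', w @ w') \<in> pres_rel X R"
  by (meson pres_rel.trans pres_rel_append_left pres_rel_append_right pres_rel_words)

lemma word_class_eq_iff:
  "v \<in> words X \<Longrightarrow> w \<in> words X \<Longrightarrow> word_class X R v = word_class X R w \<longleftrightarrow> (v, w) \<in> pres_rel X R"
  unfolding word_class_def by (rule eq_equiv_class_iff[OF equiv_pres_rel])

lemma word_class_eqI: "(v, w) \<in> pres_rel X R \<Longrightarrow> word_class X R v = word_class X R w"
  using word_class_eq_iff pres_rel_words by metis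

lemma in_word_class: "w \<in> words X \<Longrightarrow> w \<in> word_class X R w"
  unfolding word_class_def by (simp add: pres_rel.refl)

lemma word_class_memD: "v \<in> word_class X R w \<Longrightarrow> (w, v) \<in> pres_rel X R"
  unfolding word_class_def by simp

lemma carrier_pres_group: "carrier (pres_group X R) = word_class X R ` words X"
  unfolding pres_group_def word_class_def quotient_def by auto

lemma word_class_closed [simp]: "w \<in> words X \<Longrightarrow> word_class X R w \<in> carrier (pres_group X R)"
  by (simp add: carrier_pres_group)

lemma one_pres_group: "\<one>\<^bsub>pres_group X R\<^esub> = word_class X R []"
  by (simp add: pres_group_def)

lemma mult_pres_group:
  assumes "v \<in> words X" "w \<in> words X"
  shows "word_class X R v \<otimes>\<^bsub>pres_group X R\<^esub> word_class X R w = word_class X R (v @ w)"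
proof -
  let ?C = "\<lambda>a b. word_class X R (a @ b)"
  have "?C a b = ?C v w" if "a \<in> word_class X R v" "b \<in> word_class X R w" for a b
    by (rule word_class_eqI[symmetric])
      (rule pres_rel_append[OF word_class_memD[OF that(1)] word_class_memD[OF that(2)]])
  then have "(\<Union>a\<in>word_class X R v. \<Union>b\<in>word_class X R w. ?C a b) =
      (\<Union>a\<in>word_class X R v. \<Union>b\<in>word_class X R w. ?C v w)"
    by simp
  also have "\<dots> = ?C v w"
    using in_word_class[OF assms(1), of R] in_word_class[OF assms(2), of R] by blast
  finally show ?thesis by (simp add: pres_group_def)
qed

lemma word_inv_words [simp]: "w \<in> words X \<Longrightarrow> word_inv w \<in> words X"
  unfolding word_inv_def by (induction w) (auto split: prod.splits)

lemma word_inv_rel: "w \<in> words X \<Longrightarrow> (word_inv w @ w, []) \<in> pres_rel X R"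
proof (induction w)
  case Nil
  then show ?case by (simp add: word_inv_def pres_rel.refl)
next
  case (Cons a w)
  obtain x e where a: "a = (x, e)" by force
  have *: "word_inv (a # w) @ (a # w) = word_inv w @ [(x, \<not> e), (x, \<not> \<not> e)] @ w"
    by (simp add: word_inv_def a)
  have "(word_inv w @ [(x, \<not> e), (x, \<not> \<not> e)] @ w, word_inv w @ w) \<in> pres_rel X R"
    using Cons.prems a by (intro pres_rel.cancel) auto
  then show ?case using Cons unfolding * by (auto intro: pres_rel.trans)
qed

lemma group_pres_group: "group (pres_group X R)"
proof (rule groupI)
  let ?G = "pres_group X R"
  show "\<one>\<^bsub>?G\<^esub> \<in> carrier ?G" by (simp add: one_pres_group)
  fix A assume "A \<in> carrier ?G"
  then obtain a where a: "a \<in> words X" "A = word_class X R a" unfolding carrier_pres_group by blast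
  then show "\<one>\<^bsub>?G\<^esub> \<otimes>\<^bsub>?G\<^esub> A = A"
    using mult_pres_group[of "[]" X a R] by (simp add: one_pres_group)
  show "\<exists>B\<in>carrier ?G. B \<otimes>\<^bsub>?G\<^esub> A = \<one>\<^bsub>?G\<^esub>"
    using a by (intro bexI[of _ "word_class X R (word_inv a)"])
      (simp_all add: mult_pres_group one_pres_group word_class_eqI word_inv_rel)
  fix B assume "B \<in> carrier ?G"
  then obtain b where b: "b \<in> words X" "B = word_class X R b" unfolding carrier_pres_group by blast
  show "A \<otimes>\<^bsub>?G\<^esub> B \<in> carrier ?G" using a b by (simp add: mult_pres_group)
  fix C assume "C \<in> carrier ?G"
  then obtain c where c: "c \<in> words X" "C = word_class X R c" unfolding carrier_pres_group by blast
  show "A \<otimes>\<^bsub>?G\<^esub> B \<otimes>\<^bsub>?G\<^esub> C = A \<otimes>\<^bsub>?G\<^esub> (B \<otimes>\<^bsub>?G\<^esub> C)"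
    using a b c by (simp add: mult_pres_group)
qed

lemma inv_pres_group:
  assumes "w \<in> words X"
  shows "inv\<^bsub>pres_group X R\<^esub> word_class X R w = word_class X R (word_inv w)"
  by (rule group.inv_equality[OF group_pres_group])
    (use assms in \<open>simp_all add: mult_pres_group one_pres_group word_class_eqI word_inv_rel\<close>)

context group
begin

lemma word_eval_Nil [simp]: "word_eval G f [] = \<one>"
  by (simp add: word_eval_def)

lemma word_eval_Cons [simp]:
  "word_eval G f ((x, e) # w) = (if e then f x else inv f x) \<otimes> word_eval G f w"
  by (simp add: word_eval_def)

lemma word_eval_closed [simp]:
  assumes "f ` X \<subseteq> carrier G" "w \<in> words X"
  shows "word_eval G f w \<in> carrier G"
  using assms(2)
proof (induction w)
  case (Cons a w)
  then show ?case using assms(1) by (cases a) auto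
qed simp

lemma word_eval_append:
  assumes f: "f ` X \<subseteq> carrier G" and "v \<in> words X" "w \<in> words X"
  shows "word_eval G f (v @ w) = word_eval G f v \<otimes> word_eval G f w"
  using assms(2)
proof (induction v)
  case (Cons a v)
  obtain x e where a: "a = (x, e)" by force
  with Cons f have "f x \<in> carrier G" by auto
  then show ?case using Cons f a assms(3) word_eval_closed[OF f, of v] word_eval_closed[OF f, of w]
    by (simp add: m_assoc)
qed (use assms in simp)

lemma word_eval_pres_rel:
  assumes f: "f ` X \<subseteq> carrier G"
    and R: "\<And>r r'. (r, r') \<in> R \<Longrightarrow> word_eval G f r = word_eval G f r'"
    and "(v, w) \<in> pres_rel X R"
  shows "word_eval G f v = word_eval G f w"
  using assms(3)
proof (induction rule: pres_rel.induct)
  case (cancel u v x e)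
  then have "f x \<in> carrier G" using f by auto
  moreover have "word_eval G f v \<in> carrier G" using cancel f by simp
  ultimately have "word_eval G f ([(x, e), (x, \<not> e)] @ v) = word_eval G f v"
    by (cases e) (simp_all flip: m_assoc)
  then show ?case using cancel word_eval_append[OF f, of u "[(x, e), (x, \<not> e)] @ v"]
      word_eval_append[OF f, of u v] by simp
next
  case (relation u v r r')
  then show ?case using f R by (simp add: word_eval_append[OF f])
qed simp_all

lemma pres_lift_word_class:
  assumes "f ` X \<subseteq> carrier G"
    and "\<And>r r'. (r, r') \<in> R \<Longrightarrow> word_eval G f r = word_eval G f r'"
    and "w \<in> words X"
  shows "pres_lift G f (word_class X R w) = word_eval G f w"
proof -
  have "word_eval G f ` word_class X R w = {word_eval G f w}"
  proof (intro equalityI subsetI)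
    fix a assume "a \<in> word_eval G f ` word_class X R w"
    then obtain v where v: "v \<in> word_class X R w" "a = word_eval G f v" by blast
    show "a \<in> {word_eval G f w}"
      using word_eval_pres_rel[OF assms(1,2) word_class_memD[OF v(1)]] v(2) by simp
  qed (use in_word_class[OF assms(3)] in simp)
  then show ?thesis by (simp add: pres_lift_def)
qed

theorem pres_lift_hom:
  assumes "f ` X \<subseteq> carrier G"
    and "\<And>r r'. (r, r') \<in> R \<Longrightarrow> word_eval G f r = word_eval G f r'"
  shows "pres_lift G f \<in> hom (pres_group X R) G"
    and "x \<in> X \<Longrightarrow> pres_lift G f (word_class X R [(x, True)]) = f x"
proof -
  show "pres_lift G f \<in> hom (pres_group X R) G"
  proof (rule homI)
    fix A assume "A \<in> carrier (pres_group X R)"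
    then obtain a where a: "a \<in> words X" "A = word_class X R a" unfolding carrier_pres_group by blast
    then show "pres_lift G f A \<in> carrier G"
      by (simp add: pres_lift_word_class[OF assms] word_eval_closed[OF assms(1)])
    fix B assume "B \<in> carrier (pres_group X R)"
    then obtain b where b: "b \<in> words X" "B = word_class X R b" unfolding carrier_pres_group by blast
    show "pres_lift G f (A \<otimes>\<^bsub>pres_group X R\<^esub> B) = pres_lift G f A \<otimes> pres_lift G f B"
      using a b
      by (simp add: mult_pres_group pres_lift_word_class[OF assms] word_eval_append[OF assms(1)])
  qed
  show "pres_lift G f (word_class X R [(x, True)]) = f x" if "x \<in> X"
    using that assms(1) by (subst pres_lift_word_class[OF assms]) auto
qed

end


section \<open>Braid groups\<close>

datatype gen = \<sigma> nat | \<tau> nat | \<zeta>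

abbreviation pos :: "gen \<Rightarrow> gen \<times> bool" where "pos x \<equiv> (x, True)"
abbreviation neg :: "gen \<Rightarrow> gen \<times> bool" where "neg x \<equiv> (x, False)"

definition braid_rels :: "nat \<Rightarrow> (gen word \<times> gen word) set" where
  "braid_rels m =
    {([pos (\<sigma> i), pos (\<sigma> (i + 1)), pos (\<sigma> i)], [pos (\<sigma> (i + 1)), pos (\<sigma> i), pos (\<sigma> (i + 1))])
      | i. 1 \<le> i \<and> i + 1 \<le> m - 1} \<union>
    {([pos (\<sigma> i), pos (\<sigma> j)], [pos (\<sigma> j), pos (\<sigma> i)])
      | i j. i \<in> {1..m - 1} \<and> j \<in> {1..m - 1} \<and> (i + 2 \<le> j \<or> j + 2 \<le> i)}"

definition cyl_rels :: "nat \<Rightarrow> (gen word \<times> gen word) set" where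
  "cyl_rels n =
    {([pos \<zeta>, pos (\<sigma> (i + 1)), neg \<zeta>], [pos (\<sigma> i)]) | i. 1 \<le> i \<and> i \<le> n - 2} \<union>
    {([pos \<zeta>, pos \<zeta>, pos (\<sigma> 1), neg \<zeta>, neg \<zeta>], [pos (\<sigma> (n - 1))])}"

definition virtual_rels :: "nat \<Rightarrow> (gen word \<times> gen word) set" where
  "virtual_rels n =
    {([pos (\<tau> i), pos (\<tau> i)], []) | i. i \<in> {1..n - 1}} \<union>
    {([pos (\<tau> i), pos (\<tau> (i + 1)), pos (\<tau> i)], [pos (\<tau> (i + 1)), pos (\<tau> i), pos (\<tau> (i + 1))])
      | i. 1 \<le> i \<and> i + 1 \<le> n - 1} \<union>
    {([pos (\<tau> i), pos (\<tau> j)], [pos (\<tau> j), pos (\<tau> i)])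
      | i j. i \<in> {1..n - 1} \<and> j \<in> {1..n - 1} \<and> (i + 2 \<le> j \<or> j + 2 \<le> i)} \<union>
    {([pos (\<sigma> i), pos (\<tau> j)], [pos (\<tau> j), pos (\<sigma> i)])
      | i j. i \<in> {1..n - 1} \<and> j \<in> {1..n - 1} \<and> (i + 2 \<le> j \<or> j + 2 \<le> i)} \<union>
    {([pos (\<tau> i), pos (\<tau> (i + 1)), pos (\<sigma> i)], [pos (\<sigma> (i + 1)), pos (\<tau> i), pos (\<tau> (i + 1))])
      | i. 1 \<le> i \<and> i + 1 \<le> n - 1} \<union>
    {([pos \<zeta>, pos (\<tau> (i + 1)), neg \<zeta>], [pos (\<tau> i)]) | i. 1 \<le> i \<and> i \<le> n - 2} \<union>
    {([pos \<zeta>, pos \<zeta>, pos (\<tau> 1), neg \<zeta>, neg \<zeta>], [pos (\<tau> (n - 1))])}"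

abbreviation braid_gens :: "nat \<Rightarrow> gen set" where
  "braid_gens m \<equiv> \<sigma> ` {1..m - 1}"

abbreviation cyl_gens :: "nat \<Rightarrow> gen set" where
  "cyl_gens n \<equiv> insert \<zeta> (\<sigma> ` {1..n - 1})"

abbreviation virtual_gens :: "nat \<Rightarrow> gen set" where
  "virtual_gens n \<equiv> insert \<zeta> (\<sigma> ` {1..n - 1} \<union> \<tau> ` {1..n - 1})"

definition Braid :: "nat \<Rightarrow> gen word set monoid" where
  "Braid m = pres_group (braid_gens m) (braid_rels m)"

definition CB :: "nat \<Rightarrow> gen word set monoid" where
  "CB n = pres_group (cyl_gens n) (braid_rels n \<union> cyl_rels n)"

definition VCB :: "nat \<Rightarrow> gen word set monoid" where
  "VCB n = pres_group (virtual_gens n) (braid_rels n \<union> cyl_rels n \<union> virtual_rels n)"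

abbreviation B_class :: "nat \<Rightarrow> gen word \<Rightarrow> gen word set" where
  "B_class m \<equiv> word_class (braid_gens m) (braid_rels m)"

abbreviation CB_class :: "nat \<Rightarrow> gen word \<Rightarrow> gen word set" where
  "CB_class n \<equiv> word_class (cyl_gens n) (braid_rels n \<union> cyl_rels n)"

abbreviation VCB_class :: "nat \<Rightarrow> gen word \<Rightarrow> gen word set" where
  "VCB_class n \<equiv> word_class (virtual_gens n) (braid_rels n \<union> cyl_rels n \<union> virtual_rels n)"

text \<open>The product of \<open>sym_group\<close> is composition of functions, so \<open>\<zeta>\<close> has to act by
  \<open>j \<mapsto> j - 1\<close> for \<open>\<zeta> \<sigma>\<^sub>i\<^sub>+\<^sub>1 \<zeta>\<^sup>-\<^sup>1 = \<sigma>\<^sub>i\<close> to be respected.\<close>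

fun strand_perm :: "nat \<Rightarrow> gen \<Rightarrow> nat \<Rightarrow> nat" where
  "strand_perm n (\<sigma> i) = transpose i (i + 1)"
| "strand_perm n (\<tau> i) = transpose i (i + 1)"
| "strand_perm n \<zeta> = (\<lambda>j. if j = 1 then n else if 1 < j \<and> j \<le> n then j - 1 else j)"

definition PB :: "nat \<Rightarrow> gen word set monoid" where
  "PB m = (Braid m)\<lparr>carrier := kernel (Braid m) (sym_group m) (pres_lift (sym_group m) (strand_perm m))\<rparr>"

definition CPB :: "nat \<Rightarrow> gen word set monoid" where
  "CPB n = (CB n)\<lparr>carrier := kernel (CB n) (sym_group n) (pres_lift (sym_group n) (strand_perm n))\<rparr>"


section \<open>The map from pure braids to pure cylindrical braids\<close>

definition \<Delta>c :: "nat \<Rightarrow> gen word" where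
  "\<Delta>c n = map (\<lambda>i. pos (\<sigma> i)) [1..<n]"

text \<open>In the next two functions \<open>c\<close> is the current position of the distinguished strand and \<open>\<epsilon>\<close>
  records whether the letter is \<open>\<sigma>\<^sub>i\<close> or its inverse.\<close>

definition p_letter :: "nat \<Rightarrow> nat \<Rightarrow> nat \<Rightarrow> bool \<Rightarrow> gen word" where
  "p_letter n c i \<epsilon> =
    (if i + 1 < c then [(\<sigma> (c - i - 1), \<epsilon>)]
     else if i > c then [(\<sigma> (n + c - i), \<epsilon>)]
     else if i + 1 = c then (if \<epsilon> then [neg \<zeta>] else \<Delta>c n)
     else (if \<epsilon> then word_inv (\<Delta>c n) else [pos \<zeta>]))"

definition p_pos :: "nat \<Rightarrow> nat \<Rightarrow> nat" where
  "p_pos c i = (if i + 1 = c then c - 1 else if i = c then c + 1 else c)"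

fun p_word :: "nat \<Rightarrow> nat \<Rightarrow> gen word \<Rightarrow> gen word" where
  "p_word n c ((\<sigma> i, \<epsilon>) # w) = p_letter n c i \<epsilon> @ p_word n (p_pos c i) w"
| "p_word n c _ = []"

definition p_map :: "nat \<Rightarrow> nat \<Rightarrow> gen word set \<Rightarrow> gen word set" where
  "p_map n k = restrict (\<lambda>\<beta>. the_elem ((\<lambda>w. CB_class n (p_word n k w)) ` \<beta>)) (carrier (PB (n + 1)))"


section \<open>The maps to virtual cylindrical braids and to matrices\<close>

definition VCB_gen :: "nat \<Rightarrow> gen \<Rightarrow> gen word set" where
  "VCB_gen n x = VCB_class n [pos x]"

definition \<Delta>v :: "nat \<Rightarrow> gen word set" where
  "\<Delta>v n = VCB_class n (map (\<lambda>i. pos (\<tau> i)) [1..<n])"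

definition f_gen :: "nat \<Rightarrow> int \<Rightarrow> gen \<Rightarrow> gen word set" where
  "f_gen n d x =
    (if x = \<zeta> then VCB_gen n \<zeta> \<otimes>\<^bsub>VCB n\<^esub> (\<Delta>v n \<otimes>\<^bsub>VCB n\<^esub> VCB_gen n \<zeta>) [^]\<^bsub>VCB n\<^esub> (d - 1)
     else VCB_gen n x)"

definition f_map :: "nat \<Rightarrow> int \<Rightarrow> gen word set \<Rightarrow> gen word set" where
  "f_map n d = restrict (pres_lift (VCB n) (f_gen n d)) (carrier (CPB n))"

text \<open>\<open>\<int>[t\<^sup>\<plusminus>\<^sup>1, s\<^sup>\<plusminus>\<^sup>1]\<close> is the group ring of \<open>\<int>\<^sup>2\<close>: the element \<open>single (a, b) c\<close> is \<open>c t\<^sup>a s\<^sup>b\<close>, and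
  multiplication is convolution.\<close>

type_synonym laurent = "(int \<times> int) \<Rightarrow>\<^sub>0 int"

definition tL :: laurent where "tL = Poly_Mapping.single (1, 0) 1"
definition sL :: laurent where "sL = Poly_Mapping.single (0, 1) 1"
definition sL_inv :: laurent where "sL_inv = Poly_Mapping.single (0, -1) 1"

definition GL :: "nat \<Rightarrow> laurent mat monoid" where
  "GL n = units_of (ring_mat TYPE(laurent) n ())"

fun \<rho>_gen :: "nat \<Rightarrow> gen \<Rightarrow> laurent mat" where
  "\<rho>_gen n (\<sigma> j) = diag_block_mat
     [1\<^sub>m (j - 1), mat_of_rows_list 2 [[1 - tL, tL], [1, 0]], 1\<^sub>m (n - j - 1)]"
| "\<rho>_gen n (\<tau> j) = diag_block_mat
     [1\<^sub>m (j - 1), mat_of_rows_list 2 [[0, sL], [sL_inv, 0]], 1\<^sub>m (n - j - 1)]"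
| "\<rho>_gen n \<zeta> = four_block_mat (0\<^sub>m (n - 1) 1) (1\<^sub>m (n - 1)) (1\<^sub>m 1) (0\<^sub>m 1 (n - 1))"

definition \<rho>_map :: "nat \<Rightarrow> gen word set \<Rightarrow> laurent mat" where
  "\<rho>_map n = pres_lift (GL n) (\<rho>_gen n)"

end

theory Submission
  imports Defs
begin

text \<open>
  The Burau representation of the braid group on five strands is not faithful. Bigelow's proof gives
  two explicit braids whose Burau matrices commute although the braids do not: \<open>arc_twist\<close>, which is
  conjugate to a single crossing, and \<open>loop_twist\<close>, which is conjugate to the braid in which the fifth
  strand runs once around the other four. Their commutator is \<open>bigelow\<close>.

  If \<open>k \<ge> 6\<close>, this commutator can be placed on the strands in positions 1 to 5, all of them to the
  left of the strand in position \<open>k\<close>, which does not move. Then \<open>p\<^sub>k\<close> only renames the crossings, with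
  the order of the positions reversed, and it produces no \<open>\<zeta>\<close>. The covering map \<open>f\<^sub>d\<close> fixes all real
  crossings, whatever \<open>d\<close> is, and on them \<open>\<rho>\<close> is the Burau representation. To compensate for the
  reversal the braid is taken to be the image of \<open>bigelow\<close> under \<open>i \<mapsto> 5 - i\<close>.

  Three things carry the proof. The first is that the three maps are well defined: they are given on
  words, and their values on classes are accessible only once the relations are known to be respected.
  For \<open>p\<^sub>k\<close> this is \<open>p_val_pres_rel\<close>, for \<open>f\<^sub>d\<close> it is \<open>cylindrical_cover\<close>, for \<open>\<rho>\<close> it is
  \<open>gen_act_relations\<close>. The first two rest on one computation about the product of all generators
  in order, \<open>coxeter_square_shift\<close>.

  The second is that the Burau operators commute (\<open>twists_commute\<close>). All crossings are self-adjoint for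
  the form \<open>\<Sum>\<^sub>j t\<^sup>j x\<^sub>j y\<^sub>j\<close>, a crossing is a transvection \<open>x \<mapsto> x + c \<langle>e, x\<rangle> e\<close>, and the loop of the fifth
  strand multiplies by \<open>t\<close> every vector on the five positions that is orthogonal to the constant vector
  and has fifth coordinate zero. Hence it suffices that two vectors, obtained from \<open>e\<close> by words of length 26,
  have fifth coordinate zero, which is a computation with integer polynomials
  (\<open>intersection_vanish\<close>).

  The third is that the commutator is not trivial. Braids act on the colourings of the strands by any
  rack. The Burau representation is the case of Alexander racks, whose colourings the commutator
  therefore fixes; the conjugation rack of the transpositions of four letters gives a colouring that the commutator changes
  (\<open>bigelow_moves\<close>).
\<close>

section \<open>Evaluating words in groups\<close>

definition relabel :: "('x \<Rightarrow> 'y) \<Rightarrow> 'x word \<Rightarrow> 'y word" where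
  "relabel h = map (\<lambda>(x, e). (h x, e))"

lemma relabel_simps [simp]:
  "relabel h [] = []"
  "relabel h ((x, e) # w) = (h x, e) # relabel h w"
  "relabel h (v @ w) = relabel h v @ relabel h w"
  by (simp_all add: relabel_def)

lemma relabel_words: "w \<in> words X \<Longrightarrow> h ` X \<subseteq> Y \<Longrightarrow> relabel h w \<in> words Y"
  by (induction w) (auto simp: relabel_def)

lemma words_mono: "w \<in> words X \<Longrightarrow> X \<subseteq> Y \<Longrightarrow> w \<in> words Y"
  by (induction w) auto

lemma word_inv_simps [simp]:
  "word_inv [] = []"
  "word_inv ((x, e) # w) = word_inv w @ [(x, \<not> e)]"
  "word_inv (v @ w) = word_inv w @ word_inv v"
  by (simp_all add: word_inv_def)

context group
begin

lemma word_eval_relabel: "word_eval G f (relabel h w) = word_eval G (f \<circ> h) w"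
  by (induction w) (auto simp: relabel_def word_eval_def)

lemma word_eval_cong: "w \<in> words X \<Longrightarrow> (\<And>x. x \<in> X \<Longrightarrow> f x = g x) \<Longrightarrow> word_eval G f w = word_eval G g w"
  by (induction w) (auto simp: word_eval_def split: prod.splits)

lemma word_eval_word_inv:
  assumes f: "f ` X \<subseteq> carrier G" and "w \<in> words X"
  shows "word_eval G f (word_inv w) = inv (word_eval G f w)"
  using assms(2)
proof (induction w)
  case (Cons a w)
  obtain x e where a: "a = (x, e)" by force
  with Cons f have x: "f x \<in> carrier G" "x \<in> X" by auto
  have w: "w \<in> words X" using Cons.prems by simp
  have "word_eval G f w \<in> carrier G" using word_eval_closed[OF f w] .
  moreover have "word_eval G f (word_inv w @ [(x, \<not> e)]) =
      word_eval G f (word_inv w) \<otimes> word_eval G f [(x, \<not> e)]"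
    using x w by (intro word_eval_append[OF f]) auto
  ultimately show ?case using Cons.IH[OF w] x a by (simp add: inv_mult_group)
qed simp

text \<open>Conjugation is a homomorphism, so it carries powers to powers; for \<open>x' = x\<close> this says that
  centralizers are closed under powers.\<close>

lemma intertwine_int_pow:
  assumes [simp]: "x \<in> carrier G" "x' \<in> carrier G" "y \<in> carrier G" and yx: "y \<otimes> x = x' \<otimes> y"
  shows "y \<otimes> x [^] (m :: int) = x' [^] m \<otimes> y"
proof -
  have nat: "y \<otimes> x [^] j = x' [^] j \<otimes> y" for j :: nat
  proof (induction j)
    case (Suc j)
    have "y \<otimes> x [^] Suc j = (y \<otimes> x [^] j) \<otimes> x" by (simp add: m_assoc)
    also have "\<dots> = x' [^] j \<otimes> (y \<otimes> x)" by (simp add: Suc m_assoc)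
    also have "\<dots> = x' [^] Suc j \<otimes> y" by (simp add: yx m_assoc)
    finally show ?case .
  qed simp
  have inverse: "y \<otimes> inv a = inv b \<otimes> y" if "a \<in> carrier G" "b \<in> carrier G" "y \<otimes> a = b \<otimes> y" for a b
  proof -
    have "inv b \<otimes> (y \<otimes> a) \<otimes> inv a = inv b \<otimes> (b \<otimes> y) \<otimes> inv a" unfolding that(3) ..
    moreover have "inv b \<otimes> (y \<otimes> a) \<otimes> inv a = inv b \<otimes> y" using that(1,2) by (simp add: m_assoc)
    moreover have "inv b \<otimes> (b \<otimes> y) \<otimes> inv a = y \<otimes> inv a"
      using that(1,2) m_assoc[of "inv b" b y, symmetric] by simp
    ultimately show ?thesis by simp
  qed
  have "y \<otimes> inv (x [^] j) = inv (x' [^] j) \<otimes> y" for j :: nat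
    by (rule inverse[OF _ _ nat]) simp_all
  then show ?thesis using nat by (simp only: int_pow_def2 split: if_split) blast
qed

lemma conj_eqI:
  assumes "x \<in> carrier G" "y \<in> carrier G" "z \<in> carrier G" "x \<otimes> y = z \<otimes> x"
  shows "x \<otimes> (y \<otimes> inv x) = z"
  using assms by (metis inv_solve_right m_assoc inv_closed m_closed)

lemma conj_twice_eqI:
  assumes "x \<in> carrier G" "y \<in> carrier G" "z \<in> carrier G" "x \<otimes> x \<otimes> y = z \<otimes> (x \<otimes> x)"
  shows "x \<otimes> (x \<otimes> (y \<otimes> (inv x \<otimes> inv x))) = z"
  using conj_eqI[of "x \<otimes> x" y z] assms by (simp add: inv_mult_group m_assoc)

lemma conj_eqD:
  assumes "x \<in> carrier G" "y \<in> carrier G" "x \<otimes> (y \<otimes> inv x) = z"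
  shows "x \<otimes> y = z \<otimes> x"
  using assms(1,2) by (simp add: m_assoc flip: assms(3))

lemma conj_twice_eqD:
  assumes "x \<in> carrier G" "y \<in> carrier G" "x \<otimes> (x \<otimes> (y \<otimes> (inv x \<otimes> inv x))) = z"
  shows "x \<otimes> x \<otimes> y = z \<otimes> (x \<otimes> x)"
  using conj_eqD[of "x \<otimes> x" y z] assms by (simp add: inv_mult_group m_assoc)

end

text \<open>Classes of words become products in the group, so that identities between them can be proved
  in locales that know the group and some of its elements but not the presentation.\<close>

lemma word_class_eq_word_eval:
  assumes "w \<in> words X"
  shows "word_class X R w = word_eval (pres_group X R) (\<lambda>x. word_class X R [(x, True)]) w"
proof -
  interpret P: group "pres_group X R" by (rule group_pres_group)
  show ?thesis using assms
  proof (induction w)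
    case Nil
    show ?case by (simp add: one_pres_group)
  next
    case (Cons a w)
    obtain x e where a: "a = (x, e)" by force
    with Cons have x: "x \<in> X" by simp
    have letter: "(if e then word_class X R [(x, True)]
        else inv\<^bsub>pres_group X R\<^esub> word_class X R [(x, True)]) = word_class X R [(x, e)]"
      using x inv_pres_group[of "[(x, True)]" X R] by (cases e) simp_all
    have "word_class X R (a # w) =
        word_class X R [(x, e)] \<otimes>\<^bsub>pres_group X R\<^esub> word_class X R w"
      using Cons.prems x a mult_pres_group[of "[(x, e)]" X w R] by simp
    then show ?case using Cons.IH Cons.prems by (simp only: a P.word_eval_Cons letter Cons_words)
  qed
qed

lemma word_eval_relation:
  assumes "(r, r') \<in> R" "r \<in> words X" "r' \<in> words X"
  shows "word_eval (pres_group X R) (\<lambda>x. word_class X R [(x, True)]) r =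
    word_eval (pres_group X R) (\<lambda>x. word_class X R [(x, True)]) r'"
proof -
  have "(r, r') \<in> pres_rel X R" using pres_rel.relation[of "[]" X "[]" r r' R] assms by simp
  then show ?thesis using assms by (simp flip: word_class_eq_word_eval add: word_class_eqI)
qed

text \<open>Letters that act on a set by mutually inverse maps compatible with the relations make the
  presented group act on that set; \<open>foldr\<close> lets the last letter of a word act first.\<close>

lemma foldr_pres_rel:
  assumes cancel: "\<And>x e s. x \<in> X \<Longrightarrow> a (x, e) (a (x, \<not> e) s) = s"
    and R: "\<And>r r' s. (r, r') \<in> R \<Longrightarrow> foldr a r s = foldr a r' s"
    and "(v, w) \<in> pres_rel X R"
  shows "foldr a v s = foldr a w s"
  using assms(3) by (induction arbitrary: s rule: pres_rel.induct) (auto simp: cancel R)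


section \<open>Products of consecutive generators\<close>

context group
begin

text \<open>In the symmetric group this is a Coxeter element; as a braid it moves one strand across all the
  others.\<close>

primrec coxeter :: "(nat \<Rightarrow> 'a) \<Rightarrow> nat \<Rightarrow> 'a" where
  "coxeter a 0 = \<one>"
| "coxeter a (Suc m) = coxeter a m \<otimes> a (Suc m)"

lemma coxeter_closed:
  "(\<And>i. 1 \<le> i \<Longrightarrow> i \<le> m \<Longrightarrow> a i \<in> carrier G) \<Longrightarrow> coxeter a m \<in> carrier G"
  by (induction m) auto

lemma word_eval_consecutive:
  assumes "\<And>i. 1 \<le> i \<Longrightarrow> i \<le> m \<Longrightarrow> f (h i) \<in> carrier G"
  shows "word_eval G f (map (\<lambda>i. pos (h i)) [1..<Suc m]) = coxeter (\<lambda>i. f (h i)) m"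
  using assms
proof (induction m)
  case (Suc m)
  have "word_eval G f (map (\<lambda>i. pos (h i)) [1..<Suc m] @ [pos (h (Suc m))]) =
      word_eval G f (map (\<lambda>i. pos (h i)) [1..<Suc m]) \<otimes> word_eval G f [pos (h (Suc m))]"
    using Suc.prems
    by (intro word_eval_append[of _ "h ` {1..Suc m}"]) (auto simp: words_def)
  then show ?case using Suc by simp
qed simp

end

text \<open>The \<open>a i\<close> move a strand past crossings \<open>b i\<close>, as \<open>slide_up\<close> and \<open>slide_down\<close> express. In the
  applications \<open>a\<close> and \<open>b\<close> are both the real crossings, or both the virtual ones, or \<open>a\<close> are virtual
  and \<open>b\<close> real.\<close>

locale sliding = group +
  fixes a b :: "nat \<Rightarrow> 'a" and N :: nat
  assumes a_closed [simp]: "1 \<le> i \<Longrightarrow> i \<le> N \<Longrightarrow> a i \<in> carrier G"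
    and b_closed [simp]: "1 \<le> i \<Longrightarrow> i \<le> N \<Longrightarrow> b i \<in> carrier G"
    and braid: "1 \<le> i \<Longrightarrow> i < N \<Longrightarrow> a i \<otimes> (a (i + 1) \<otimes> a i) = a (i + 1) \<otimes> (a i \<otimes> a (i + 1))"
    and far: "1 \<le> i \<Longrightarrow> i + 2 \<le> j \<Longrightarrow> j \<le> N \<Longrightarrow> a i \<otimes> a j = a j \<otimes> a i"
    and far_mixed: "1 \<le> i \<Longrightarrow> i \<le> N \<Longrightarrow> 1 \<le> j \<Longrightarrow> j \<le> N \<Longrightarrow> i + 2 \<le> j \<or> j + 2 \<le> i \<Longrightarrow>
      b i \<otimes> a j = a j \<otimes> b i"
    and slide_up: "1 \<le> i \<Longrightarrow> i < N \<Longrightarrow> a i \<otimes> (a (i + 1) \<otimes> b i) = b (i + 1) \<otimes> (a i \<otimes> a (i + 1))"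
    and slide_down: "1 \<le> i \<Longrightarrow> i < N \<Longrightarrow>
      a (i + 1) \<otimes> (a i \<otimes> b (i + 1)) = b i \<otimes> (a (i + 1) \<otimes> a i)"
    and square: "1 \<le> N \<Longrightarrow> a 1 \<otimes> (a 1 \<otimes> b 1) = b 1 \<otimes> (a 1 \<otimes> a 1)"
begin

lemma coxeter_a_closed [simp]: "m \<le> N \<Longrightarrow> coxeter a m \<in> carrier G"
  by (rule coxeter_closed) simp

lemma coxeter_far: "m + 2 \<le> i \<Longrightarrow> i \<le> N \<Longrightarrow> coxeter a m \<otimes> b i = b i \<otimes> coxeter a m"
proof (induction m)
  case (Suc m)
  have "coxeter a m \<otimes> a (Suc m) \<otimes> b i = coxeter a m \<otimes> (b i \<otimes> a (Suc m))"
    using Suc.prems far_mixed[of i "Suc m"] by (simp add: m_assoc)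
  also have "\<dots> = (coxeter a m \<otimes> b i) \<otimes> a (Suc m)" using Suc.prems by (simp add: m_assoc)
  also have "\<dots> = b i \<otimes> (coxeter a m \<otimes> a (Suc m))" using Suc by (simp add: m_assoc)
  finally show ?case by simp
qed simp

lemma coxeter_far_self: "m + 2 \<le> i \<Longrightarrow> i \<le> N \<Longrightarrow> coxeter a m \<otimes> a i = a i \<otimes> coxeter a m"
proof (induction m)
  case (Suc m)
  have "coxeter a m \<otimes> a (Suc m) \<otimes> a i = coxeter a m \<otimes> (a i \<otimes> a (Suc m))"
    using Suc.prems far[of "Suc m" i] by (simp add: m_assoc)
  also have "\<dots> = (coxeter a m \<otimes> a i) \<otimes> a (Suc m)" using Suc.prems by (simp add: m_assoc)
  also have "\<dots> = a i \<otimes> (coxeter a m \<otimes> a (Suc m))" using Suc by (simp add: m_assoc)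
  finally show ?case by simp
qed simp

lemma coxeter_shift:
  "m \<le> N \<Longrightarrow> 1 \<le> i \<Longrightarrow> i < m \<Longrightarrow> coxeter a m \<otimes> b i = b (i + 1) \<otimes> coxeter a m"
proof (induction m)
  case (Suc m)
  show ?case
  proof (cases "i < m")
    case True
    have "coxeter a m \<otimes> a (Suc m) \<otimes> b i = coxeter a m \<otimes> (b i \<otimes> a (Suc m))"
      using Suc.prems True far_mixed[of i "Suc m"] by (simp add: m_assoc)
    also have "\<dots> = (coxeter a m \<otimes> b i) \<otimes> a (Suc m)" using Suc.prems by (simp add: m_assoc)
    also have "\<dots> = b (i + 1) \<otimes> (coxeter a m \<otimes> a (Suc m))"
      using Suc True by (simp add: m_assoc)
    finally show ?thesis by simp
  next
    case False
    with Suc.prems have "i = m" by simp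
    with Suc.prems obtain l where m: "m = Suc l" "i = Suc l" by (cases m) auto
    have N: "Suc (Suc l) \<le> N" using Suc.prems m by simp
    have "coxeter a (Suc m) \<otimes> b i = coxeter a l \<otimes> (a i \<otimes> (a (i + 1) \<otimes> b i))"
      using N by (simp add: m m_assoc)
    also have "\<dots> = (coxeter a l \<otimes> b (i + 1)) \<otimes> (a i \<otimes> a (i + 1))"
      using N slide_up[of i] by (simp add: m m_assoc)
    also have "\<dots> = b (i + 1) \<otimes> coxeter a (Suc m)"
      using N coxeter_far[of l "i + 1"] by (simp add: m m_assoc)
    finally show ?thesis .
  qed
qed simp

text \<open>The last factor of the first product commutes with all but the end of the second product;
  the braid relation then turns the end into a form to which induction applies.\<close>

lemma coxeter_square_Suc:
  assumes "1 \<le> m" "m < N"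
  shows "coxeter a (Suc m) \<otimes> coxeter a (Suc m) = coxeter a m \<otimes> coxeter a m \<otimes> (a (m + 1) \<otimes> a m)"
proof -
  obtain l where m: "m = Suc l" using assms by (cases m) auto
  have N: "Suc (Suc l) \<le> N" using assms m by simp
  have comm: "a (m + 1) \<otimes> coxeter a l = coxeter a l \<otimes> a (m + 1)"
    using N coxeter_far_self[of l "m + 1"] by (simp add: m)
  have "coxeter a (Suc m) \<otimes> coxeter a (Suc m) =
      coxeter a m \<otimes> (a (m + 1) \<otimes> coxeter a l) \<otimes> (a m \<otimes> a (m + 1))"
    using N by (simp add: m m_assoc)
  also have "\<dots> = coxeter a m \<otimes> coxeter a l \<otimes> (a (m + 1) \<otimes> (a m \<otimes> a (m + 1)))"
    unfolding comm using N by (simp add: m m_assoc)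
  also have "\<dots> = coxeter a m \<otimes> coxeter a l \<otimes> (a m \<otimes> (a (m + 1) \<otimes> a m))"
    using N braid[of m] by (simp add: m)
  also have "\<dots> = coxeter a m \<otimes> coxeter a m \<otimes> (a (m + 1) \<otimes> a m)"
    using N by (simp add: m m_assoc)
  finally show ?thesis .
qed

text \<open>The square moves two strands across all the others, and so carries the crossing of these two from
  one end to the other. By \<open>coxeter_shift\<close> conjugation by a single product only raises the index, which
  leaves out the last crossing; the square handles that one.\<close>

lemma coxeter_square_shift:
  "1 \<le> m \<Longrightarrow> m \<le> N \<Longrightarrow> coxeter a m \<otimes> coxeter a m \<otimes> b m = b 1 \<otimes> (coxeter a m \<otimes> coxeter a m)"
proof (induction m)
  case (Suc m)
  show ?case
  proof (cases "m = 0")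
    case True
    then show ?thesis using Suc.prems square by (simp add: m_assoc)
  next
    case False
    have N: "1 \<le> m" "m < N" using Suc.prems False by auto
    have "coxeter a (Suc m) \<otimes> coxeter a (Suc m) \<otimes> b (Suc m) =
        coxeter a m \<otimes> coxeter a m \<otimes> (a (m + 1) \<otimes> (a m \<otimes> b (m + 1)))"
      unfolding coxeter_square_Suc[OF N] using N by (simp add: m_assoc)
    also have "\<dots> = coxeter a m \<otimes> coxeter a m \<otimes> b m \<otimes> (a (m + 1) \<otimes> a m)"
      using N slide_down[of m] by (simp add: m_assoc)
    also have "\<dots> = b 1 \<otimes> (coxeter a (Suc m) \<otimes> coxeter a (Suc m))"
      unfolding coxeter_square_Suc[OF N] using N Suc.IH by (simp add: m_assoc)
    finally show ?thesis .
  qed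
qed simp

end

section \<open>Strand permutations\<close>

lemma strand_perm_\<sigma>: "i \<in> {1..n - 1} \<Longrightarrow> strand_perm n (\<sigma> i) \<in> carrier (sym_group n)"
  by (auto simp: sym_group_carrier intro!: permutes_swap_id)

lemma strand_perm_\<zeta>: "1 \<le> n \<Longrightarrow> strand_perm n \<zeta> \<in> carrier (sym_group n)"
  unfolding sym_group_carrier
proof (rule bij_imp_permutes)
  assume "1 \<le> n"
  then show "bij_betw (strand_perm n \<zeta>) {1..n} {1..n}"
    by (intro bij_betw_byWitness[where f' = "\<lambda>j. if j = n then 1 else j + 1"]) auto
qed auto

lemma strand_perm_cyl: "2 \<le> n \<Longrightarrow> strand_perm n ` cyl_gens n \<subseteq> carrier (sym_group n)"
  using strand_perm_\<sigma> strand_perm_\<zeta> by (auto simp del: strand_perm.simps)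

lemma strand_perm_braid: "strand_perm n ` braid_gens n \<subseteq> carrier (sym_group n)"
  using strand_perm_\<sigma> by (auto simp del: strand_perm.simps)

lemma strand_perm_braid_rels:
  assumes "(r, r') \<in> braid_rels n"
  shows "word_eval (sym_group n) (strand_perm n) r = word_eval (sym_group n) (strand_perm n) r'"
proof -
  interpret S: group "sym_group n" by (rule sym_group_is_group)
  have braid: "transpose i (i + 1) (transpose (i + 1) (i + 2) (transpose i (i + 1) x)) =
      transpose (i + 1) (i + 2) (transpose i (i + 1) (transpose (i + 1) (i + 2) x))" for i x :: nat
  proof -
    consider "x = i" | "x = i + 1" | "x = i + 2" | "x \<notin> {i, i + 1, i + 2}" by blast
    then show ?thesis by cases (simp_all add: transpose_def)
  qed
  have far: "transpose i (i + 1) (transpose j (j + 1) x) = transpose j (j + 1) (transpose i (i + 1) x)"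
    if "i + 2 \<le> j \<or> j + 2 \<le> i" for i j x :: nat
  proof -
    consider "x = i" | "x = i + 1" | "x = j" | "x = j + 1" | "x \<notin> {i, i + 1, j, j + 1}" by blast
    then show ?thesis using that by cases (auto simp: transpose_def)
  qed
  from assms consider
    i where "r = [pos (\<sigma> i), pos (\<sigma> (i + 1)), pos (\<sigma> i)]"
      "r' = [pos (\<sigma> (i + 1)), pos (\<sigma> i), pos (\<sigma> (i + 1))]"
  | i j where "i + 2 \<le> j \<or> j + 2 \<le> i" "r = [pos (\<sigma> i), pos (\<sigma> j)]" "r' = [pos (\<sigma> j), pos (\<sigma> i)]"
    unfolding braid_rels_def by blast
  then show ?thesis
  proof cases
    case 1
    then show ?thesis using braid[of i] by (simp add: sym_group_mult sym_group_one fun_eq_iff)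
  next
    case 2
    then show ?thesis using far[OF 2(1)] by (simp add: sym_group_mult sym_group_one fun_eq_iff)
  qed
qed

lemma strand_perm_cyl_rels:
  assumes "3 \<le> n" "(r, r') \<in> braid_rels n \<union> cyl_rels n"
  shows "word_eval (sym_group n) (strand_perm n) r = word_eval (sym_group n) (strand_perm n) r'"
proof (cases "(r, r') \<in> braid_rels n")
  case False
  interpret S: group "sym_group n" by (rule sym_group_is_group)
  have \<sigma>: "strand_perm n (\<sigma> i) \<in> carrier (sym_group n)" if "1 \<le> i" "i \<le> n - 1" for i
    using strand_perm_\<sigma>[of i n] that by (simp del: strand_perm.simps)
  have \<zeta>: "strand_perm n \<zeta> \<in> carrier (sym_group n)"
    using strand_perm_\<zeta>[of n] assms(1) by (simp del: strand_perm.simps)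
  from False assms consider
    i where "1 \<le> i" "i \<le> n - 2" "r = [pos \<zeta>, pos (\<sigma> (i + 1)), neg \<zeta>]" "r' = [pos (\<sigma> i)]"
  | "r = [pos \<zeta>, pos \<zeta>, pos (\<sigma> 1), neg \<zeta>, neg \<zeta>]" "r' = [pos (\<sigma> (n - 1))]"
    by (auto simp: cyl_rels_def)
  then show ?thesis
  proof cases
    case 1
    have "strand_perm n \<zeta> \<circ> strand_perm n (\<sigma> (i + 1)) = strand_perm n (\<sigma> i) \<circ> strand_perm n \<zeta>"
      using 1(1,2) by (auto simp: fun_eq_iff transpose_def)
    then show ?thesis
      using S.conj_eqI[OF \<zeta> \<sigma>[of "i + 1"] \<sigma>[of i]] 1 \<sigma>[of i] \<zeta> S.inv_closed[OF \<zeta>]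
      by (simp add: sym_group_mult sym_group_one del: strand_perm.simps)
  next
    case 2
    have "strand_perm n \<zeta> \<circ> strand_perm n \<zeta> \<circ> strand_perm n (\<sigma> 1) =
        strand_perm n (\<sigma> (n - 1)) \<circ> (strand_perm n \<zeta> \<circ> strand_perm n \<zeta>)"
    proof
      fix x
      consider "x = 0" | "x = 1" | "x = 2" | "3 \<le> x" "x \<le> n" | "n < x" by linarith
      then show "(strand_perm n \<zeta> \<circ> strand_perm n \<zeta> \<circ> strand_perm n (\<sigma> 1)) x =
          (strand_perm n (\<sigma> (n - 1)) \<circ> (strand_perm n \<zeta> \<circ> strand_perm n \<zeta>)) x"
        using assms(1) by cases (auto simp: transpose_def)
    qed
    then show ?thesis
      using S.conj_twice_eqI[OF \<zeta> \<sigma>[of 1] \<sigma>[of "n - 1"]] 2 \<sigma>[of "n - 1"] \<zeta> S.inv_closed[OF \<zeta>] assms(1)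
      by (simp add: sym_group_mult sym_group_one del: strand_perm.simps)
  qed
qed (rule strand_perm_braid_rels)


section \<open>From pure braids to the cylinder\<close>

text \<open>Maps on classes that are defined by choosing a word can be computed on any word once they are
  invariant.\<close>

lemma the_elem_image_word_class:
  assumes "w \<in> words X" and f: "\<And>v. (w, v) \<in> pres_rel X R \<Longrightarrow> f v = f w"
  shows "the_elem (f ` word_class X R w) = f w"
proof -
  have "f ` word_class X R w = {f w}"
  proof (intro equalityI subsetI)
    fix a assume "a \<in> f ` word_class X R w"
    then obtain v where "v \<in> word_class X R w" "a = f v" by blast
    then show "a \<in> {f w}" using f[OF word_class_memD] by simp
  qed (use in_word_class[OF assms(1)] in simp)
  then show ?thesis by simp
qed

text \<open>The relations of the cylindrical braid group for elements of an arbitrary group. Besides the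
  tautological case this is used for the images under the covering map, where \<open>z\<close> is not the image of a
  single letter, and for the virtual crossings in the role of \<open>s\<close>.\<close>

locale cylindrical = group +
  fixes n :: nat and s :: "nat \<Rightarrow> 'a" and z :: 'a
  assumes n: "3 \<le> n"
    and s_closed [simp]: "1 \<le> i \<Longrightarrow> i \<le> n - 1 \<Longrightarrow> s i \<in> carrier G"
    and z_closed [simp]: "z \<in> carrier G"
    and s_braid: "1 \<le> i \<Longrightarrow> i + 1 \<le> n - 1 \<Longrightarrow>
      s i \<otimes> (s (i + 1) \<otimes> s i) = s (i + 1) \<otimes> (s i \<otimes> s (i + 1))"
    and s_far: "1 \<le> i \<Longrightarrow> i \<le> n - 1 \<Longrightarrow> 1 \<le> j \<Longrightarrow> j \<le> n - 1 \<Longrightarrow> i + 2 \<le> j \<or> j + 2 \<le> i \<Longrightarrow>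
      s i \<otimes> s j = s j \<otimes> s i"
    and z_shift: "1 \<le> i \<Longrightarrow> i \<le> n - 2 \<Longrightarrow> z \<otimes> s (i + 1) = s i \<otimes> z"
    and z_wrap: "z \<otimes> z \<otimes> s 1 = s (n - 1) \<otimes> (z \<otimes> z)"
begin

sublocale sliding G s s "n - 1"
proof unfold_locales
  show "s i \<otimes> (s (i + 1) \<otimes> s i) = s (i + 1) \<otimes> (s i \<otimes> s (i + 1))" if "1 \<le> i" "i < n - 1" for i
    using s_braid[of i] that by simp
  then show "s (i + 1) \<otimes> (s i \<otimes> s (i + 1)) = s i \<otimes> (s (i + 1) \<otimes> s i)" if "1 \<le> i" "i < n - 1" for i
    using that by metis
qed (auto intro: s_far)

abbreviation \<Delta> :: 'a where "\<Delta> \<equiv> coxeter s (n - 1)"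

lemma inverse_intertwine:
  assumes "x \<in> carrier G" "y \<in> carrier G" "y' \<in> carrier G" "x \<otimes> y = y' \<otimes> x"
  shows "inv x \<otimes> y' = y \<otimes> inv x"
proof -
  have "inv x \<otimes> (x \<otimes> y) \<otimes> inv x = inv x \<otimes> (y' \<otimes> x) \<otimes> inv x" unfolding assms(4) ..
  moreover have "inv x \<otimes> (x \<otimes> y) = y" using assms(1,2) m_assoc[of "inv x" x y, symmetric] by simp
  moreover have "inv x \<otimes> (y' \<otimes> x) \<otimes> inv x = inv x \<otimes> y'" using assms(1,3) by (simp add: m_assoc)
  ultimately show ?thesis by simp
qed

lemma \<Delta>_inv_shift: "1 \<le> i \<Longrightarrow> i + 1 \<le> n - 1 \<Longrightarrow> inv \<Delta> \<otimes> s (i + 1) = s i \<otimes> inv \<Delta>"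
  by (rule inverse_intertwine) (simp_all add: coxeter_shift)

lemma \<Delta>_inv_wrap: "inv \<Delta> \<otimes> (inv \<Delta> \<otimes> s 1) = s (n - 1) \<otimes> (inv \<Delta> \<otimes> inv \<Delta>)"
proof -
  have "inv (\<Delta> \<otimes> \<Delta>) \<otimes> s 1 = s (n - 1) \<otimes> inv (\<Delta> \<otimes> \<Delta>)"
    using n coxeter_square_shift[of "n - 1"] by (intro inverse_intertwine) simp_all
  then show ?thesis using n by (simp add: inv_mult_group m_assoc)
qed

lemma z_inv_shift: "1 \<le> i \<Longrightarrow> i + 1 \<le> n - 1 \<Longrightarrow> inv z \<otimes> s i = s (i + 1) \<otimes> inv z"
  by (rule inverse_intertwine) (use z_shift in simp_all)

lemma z_inv_wrap: "inv z \<otimes> (inv z \<otimes> s (n - 1)) = s 1 \<otimes> (inv z \<otimes> inv z)"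
proof -
  have "inv (z \<otimes> z) \<otimes> s (n - 1) = s 1 \<otimes> inv (z \<otimes> z)"
    using n z_wrap by (intro inverse_intertwine) simp_all
  then show ?thesis using n by (simp add: inv_mult_group m_assoc)
qed

lemma z_inv_coxeter: "m + 1 \<le> n - 1 \<Longrightarrow> coxeter (\<lambda>i. s (i + 1)) m \<otimes> inv z = inv z \<otimes> coxeter s m"
proof (induction m)
  case (Suc m)
  have [simp]: "coxeter (\<lambda>i. s (Suc i)) m \<in> carrier G"
    using Suc.prems by (intro coxeter_closed) simp
  have "coxeter (\<lambda>i. s (i + 1)) (Suc m) \<otimes> inv z = coxeter (\<lambda>i. s (i + 1)) m \<otimes> (inv z \<otimes> s (Suc m))"
    using Suc.prems z_inv_shift[of "Suc m"] by (simp add: m_assoc)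
  also have "\<dots> = (coxeter (\<lambda>i. s (i + 1)) m \<otimes> inv z) \<otimes> s (Suc m)"
    using Suc.prems by (simp add: m_assoc)
  also have "\<dots> = inv z \<otimes> coxeter s (Suc m)" using Suc by (simp add: m_assoc)
  finally show ?case .
qed simp

lemma coxeter_split_first: "m + 1 \<le> n - 1 \<Longrightarrow> coxeter s (Suc m) = s 1 \<otimes> coxeter (\<lambda>i. s (i + 1)) m"
proof (induction m)
  case (Suc m)
  have "coxeter (\<lambda>i. s (i + 1)) m \<in> carrier G"
    using Suc.prems by (intro coxeter_closed) simp
  then show ?case using Suc by (simp add: m_assoc)
qed simp

text \<open>Both sides are \<open>inv z\<close> composed with the inverse of a product of all crossings but one: on the left
  the last crossing is cancelled, on the right the first, and \<open>inv z\<close> shifts the remaining ones into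
  each other.\<close>

lemma \<Delta>_inv_z: "inv z \<otimes> (s (n - 1) \<otimes> inv \<Delta>) = inv \<Delta> \<otimes> (s 1 \<otimes> inv z)"
proof -
  define c where "c = coxeter s (n - 2)"
  define c' where "c' = coxeter (\<lambda>i. s (i + 1)) (n - 2)"
  have n1: "n - 1 = Suc (n - 2)" using n by simp
  have [simp]: "c \<in> carrier G" "c' \<in> carrier G"
    unfolding c_def c'_def using n by (auto intro!: coxeter_closed)
  have [simp]: "s (n - 1) \<in> carrier G" "s 1 \<in> carrier G" using n by simp_all
  have c: "\<Delta> = c \<otimes> s (n - 1)" unfolding c_def n1 by simp
  have c': "\<Delta> = s 1 \<otimes> c'" unfolding c'_def n1 by (rule coxeter_split_first) (use n in simp)
  have "s (n - 1) \<otimes> inv \<Delta> = inv c"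
    unfolding c using n by (simp add: inv_mult_group flip: m_assoc)
  moreover have "inv \<Delta> \<otimes> (s 1 \<otimes> inv z) = inv c' \<otimes> inv z"
    unfolding c' using m_assoc[of "inv s 1" "s 1" "inv z", symmetric]
    by (simp add: inv_mult_group m_assoc del: One_nat_def)
  moreover have "inv c' \<otimes> inv z = inv z \<otimes> inv c"
  proof -
    have "c' \<otimes> inv z = inv z \<otimes> c"
      unfolding c_def c'_def using z_inv_coxeter[of "n - 2"] n by simp
    then have "inv c' \<otimes> (inv z \<otimes> c) = inv z"
      using m_assoc[of "inv c'" c' "inv z", symmetric] by simp
    then have "inv c' \<otimes> inv z \<otimes> (c \<otimes> inv c) = inv z \<otimes> inv c"
      by (simp only: m_assoc[symmetric] inv_closed m_closed z_closed \<open>c \<in> carrier G\<close> \<open>c' \<in> carrier G\<close>)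
    then show ?thesis by simp
  qed
  ultimately show ?thesis by simp
qed

definition val :: "gen \<Rightarrow> 'a" where
  "val x = (case x of \<sigma> i \<Rightarrow> s i | \<tau> i \<Rightarrow> \<one> | \<zeta> \<Rightarrow> z)"

lemma val_simps [simp]: "val (\<sigma> i) = s i" "val \<zeta> = z"
  by (simp_all add: val_def)

lemma val_closed: "val ` cyl_gens n \<subseteq> carrier G"
  by auto

text \<open>The value of a positive crossing \<open>\<sigma>\<^sub>i\<close> when the distinguished strand is at \<open>c\<close>. A negative crossing
  undoes the positive one that starts from the position reached, which is why \<open>p_letter_val\<close> has
  \<open>letter (p_pos c i) i\<close>.\<close>

definition letter :: "nat \<Rightarrow> nat \<Rightarrow> 'a" where
  "letter c i = (if i + 1 < c then s (c - i - 1) else if c < i then s (n + c - i)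
     else if i + 1 = c then inv z else inv \<Delta>)"

lemma letter_left: "i + 1 < c \<Longrightarrow> letter c i = s (c - i - 1)"
  and letter_right: "c < i \<Longrightarrow> letter c i = s (n + c - i)"
  and letter_down: "i + 1 = c \<Longrightarrow> letter c i = inv z"
  and letter_up: "letter i i = inv \<Delta>"
  by (auto simp: letter_def)

lemma letter_closed [simp]:
  "c \<in> {1..n + 1} \<Longrightarrow> i \<in> {1..n} \<Longrightarrow> letter c i \<in> carrier G"
  by (auto simp: letter_def)

lemma p_pos_range: "c \<in> {1..n + 1} \<Longrightarrow> i \<in> {1..n} \<Longrightarrow> p_pos c i \<in> {1..n + 1}"
  by (auto simp: p_pos_def)

lemma p_pos_bounds [simp]:
  "1 \<le> c \<Longrightarrow> 1 \<le> i \<Longrightarrow> Suc 0 \<le> p_pos c i"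
  "c \<le> n + 1 \<Longrightarrow> i \<le> n \<Longrightarrow> p_pos c i \<le> Suc n"
  by (auto simp: p_pos_def)

lemma p_pos_p_pos [simp]: "1 \<le> c \<Longrightarrow> p_pos (p_pos c i) i = c"
  by (auto simp: p_pos_def)

lemma \<Delta>c_words: "\<Delta>c n \<in> words (cyl_gens n)"
  using n by (auto simp: \<Delta>c_def words_def)

lemma p_letter_words:
  "c \<in> {1..n + 1} \<Longrightarrow> i \<in> {1..n} \<Longrightarrow> p_letter n c i e \<in> words (cyl_gens n)"
  using \<Delta>c_words by (auto simp: p_letter_def intro!: imageI)

lemma \<Delta>c_val: "word_eval G val (\<Delta>c n) = \<Delta>"
proof -
  have "word_eval G val (map (\<lambda>i. pos (\<sigma> i)) [1..<Suc (n - 1)]) = coxeter (\<lambda>i. val (\<sigma> i)) (n - 1)"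
    by (rule word_eval_consecutive) simp
  then show ?thesis using n by (simp add: \<Delta>c_def)
qed

lemma p_letter_val:
  assumes "c \<in> {1..n + 1}" "i \<in> {1..n}"
  shows "word_eval G val (p_letter n c i e) =
    (if e then letter c i else inv (letter (p_pos c i) i))"
proof -
  have \<Delta>: "word_eval G val (word_inv (\<Delta>c n)) = inv \<Delta>"
    using word_eval_word_inv[OF val_closed \<Delta>c_words] by (simp add: \<Delta>c_val)
  have [simp]: "\<Delta> \<in> carrier G" by simp
  consider "i + 1 < c" | "c < i" | "i + 1 = c" | "i = c" by linarith
  then show ?thesis
  proof cases
    case 1
    then have "p_pos c i = c" by (simp add: p_pos_def)
    with 1 show ?thesis using assms by (cases e) (simp_all add: p_letter_def letter_def)
  next
    case 2
    then have "p_pos c i = c" by (simp add: p_pos_def)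
    with 2 show ?thesis using assms by (cases e) (simp_all add: p_letter_def letter_def)
  next
    case 3
    then have "p_pos c i = i" by (auto simp: p_pos_def)
    with 3 show ?thesis using assms by (cases e) (auto simp: p_letter_def letter_def \<Delta>c_val)
  next
    case 4
    then have "p_pos c i = i + 1" by (simp add: p_pos_def)
    with 4 show ?thesis using assms by (cases e) (auto simp: p_letter_def letter_def \<Delta>)
  qed
qed

primrec track :: "nat \<Rightarrow> gen word \<Rightarrow> nat" where
  "track c [] = c"
| "track c (a # w) = track (case fst a of \<sigma> i \<Rightarrow> p_pos c i | _ \<Rightarrow> c) w"

lemma track_append [simp]: "track c (v @ w) = track (track c v) w"
  by (induction v arbitrary: c) auto

lemma track_range: "w \<in> words (braid_gens (n + 1)) \<Longrightarrow> c \<in> {1..n + 1} \<Longrightarrow> track c w \<in> {1..n + 1}"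
proof (induction w arbitrary: c)
  case (Cons a w)
  then show ?case using p_pos_range by (auto simp del: atLeastAtMost_iff)
qed simp

lemma p_word_words:
  "w \<in> words (braid_gens (n + 1)) \<Longrightarrow> c \<in> {1..n + 1} \<Longrightarrow> p_word n c w \<in> words (cyl_gens n)"
proof (induction w arbitrary: c)
  case (Cons a w)
  then obtain i e where a: "a = (\<sigma> i, e)" "i \<in> {1..n}" by (cases a) auto
  then show ?case
    using Cons p_letter_words[of c i e] p_pos_range[of c i] by (simp del: atLeastAtMost_iff)
qed simp

lemma p_word_append:
  "v \<in> words (braid_gens (n + 1)) \<Longrightarrow>
    p_word n c (v @ w) = p_word n c v @ p_word n (track c v) w"
  by (induction v arbitrary: c) auto

definition p_val :: "nat \<Rightarrow> gen word \<Rightarrow> 'a" where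
  "p_val c w = word_eval G val (p_word n c w)"

lemma p_val_closed:
  "w \<in> words (braid_gens (n + 1)) \<Longrightarrow> c \<in> {1..n + 1} \<Longrightarrow> p_val c w \<in> carrier G"
  unfolding p_val_def by (rule word_eval_closed[OF val_closed p_word_words])

lemma p_val_append:
  "v \<in> words (braid_gens (n + 1)) \<Longrightarrow> w \<in> words (braid_gens (n + 1)) \<Longrightarrow> c \<in> {1..n + 1} \<Longrightarrow>
    p_val c (v @ w) = p_val c v \<otimes> p_val (track c v) w"
  unfolding p_val_def p_word_append
  by (intro word_eval_append[OF val_closed] p_word_words track_range)

lemma p_val_Nil [simp]: "p_val c [] = \<one>"
  by (simp add: p_val_def)

lemma p_val_Cons:
  assumes "i \<in> {1..n}" "w \<in> words (braid_gens (n + 1))" "c \<in> {1..n + 1}"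
  shows "p_val c ((\<sigma> i, e) # w) =
    (if e then letter c i else inv (letter (p_pos c i) i)) \<otimes> p_val (p_pos c i) w"
  using assms p_val_append[of "[(\<sigma> i, e)]" w c]
  by (simp add: p_val_def p_letter_val del: atLeastAtMost_iff)

text \<open>The distinguished strand is to the right of the three strands involved, to their left, or is one of
  them. In the last three cases its crossings become \<open>\<zeta>\<^sup>-\<^sup>1\<close> or \<open>\<Delta>\<^sup>-\<^sup>1\<close>, and the single crossing of the
  other two is carried across them.\<close>

lemma p_val_braid:
  assumes i: "1 \<le> i" "i + 1 \<le> n" and c: "c \<in> {1..n + 1}"
  shows "letter c i \<otimes> (letter (p_pos c i) (i + 1) \<otimes> letter (p_pos (p_pos c i) (i + 1)) i) =
    letter c (i + 1) \<otimes> (letter (p_pos c (i + 1)) i \<otimes> letter (p_pos (p_pos c (i + 1)) i) (i + 1))"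
proof -
  consider "i + 2 < c" | "c < i" | "c = i" | "c = i + 1" | "c = i + 2" by linarith
  then show ?thesis
  proof cases
    case 1
    then show ?thesis using i c s_braid[of "c - i - 2"]
      by (simp add: letter_left p_pos_def Suc_diff_Suc numeral_2_eq_2)
  next
    case 2
    then show ?thesis using i c s_braid[of "n + c - i - 1"]
      by (simp add: letter_right p_pos_def Suc_diff_Suc)
  next
    case 3
    then show ?thesis using i c \<Delta>_inv_wrap
      by (simp add: letter_left letter_right letter_up p_pos_def)
  next
    case 4
    then show ?thesis using i c \<Delta>_inv_z
      by (simp add: letter_left letter_right letter_up letter_down p_pos_def)
  next
    case 5
    then show ?thesis using i c z_inv_wrap
      by (simp add: letter_left letter_right letter_up letter_down p_pos_def)
  qed
qed

lemma p_val_far: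
  assumes ij: "1 \<le> i" "i + 2 \<le> j" "j \<le> n" and c: "c \<in> {1..n + 1}"
  shows "letter c i \<otimes> letter (p_pos c i) j = letter c j \<otimes> letter (p_pos c j) i"
proof -
  consider "j + 1 < c" | "c = j + 1" | "c = j" | "i + 1 < c" "c < j" | "c = i + 1" | "c = i" | "c < i"
    by linarith
  then show ?thesis
  proof cases
    case 1
    then have "s (c - i - 1) \<otimes> s (c - j - 1) = s (c - j - 1) \<otimes> s (c - i - 1)"
      using ij c by (intro s_far) auto
    then show ?thesis using 1 ij c by (simp add: letter_left p_pos_def)
  next
    case 2
    then show ?thesis using ij c z_inv_shift[of "j - i - 1"]
      by (simp add: letter_left letter_down p_pos_def Suc_diff_Suc)
  next
    case 3
    then show ?thesis using ij c \<Delta>_inv_shift[of "j - i - 1"]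
      by (simp add: letter_left letter_up p_pos_def Suc_diff_Suc)
  next
    case 4
    then have "s (c - i - 1) \<otimes> s (n + c - j) = s (n + c - j) \<otimes> s (c - i - 1)"
      using ij c by (intro s_far) auto
    then show ?thesis using 4 ij c by (simp add: letter_left letter_right p_pos_def)
  next
    case 5
    then show ?thesis using ij c z_inv_shift[of "n + i - j"]
      by (simp add: letter_right letter_down p_pos_def Suc_diff_le)
  next
    case 6
    then show ?thesis using ij c \<Delta>_inv_shift[of "n + i - j"]
      by (simp add: letter_right letter_up p_pos_def Suc_diff_le)
  next
    case 7
    then have "s (n + c - i) \<otimes> s (n + c - j) = s (n + c - j) \<otimes> s (n + c - i)"
      using ij c by (intro s_far) auto
    then show ?thesis using 7 ij c by (simp add: letter_right p_pos_def)
  qed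
qed

text \<open>The value of a suffix depends on the position that the distinguished strand has reached, so the
  invariance of that position has to be carried through the induction.\<close>

lemma p_val_pres_rel:
  assumes "(v, w) \<in> pres_rel (braid_gens (n + 1)) (braid_rels (n + 1))" "c \<in> {1..n + 1}"
  shows "track c v = track c w \<and> p_val c v = p_val c w"
  using assms
proof (induction arbitrary: c rule: pres_rel.induct)
  case (cancel u v x e)
  define c' where "c' = track c u"
  have c': "c' \<in> {1..n + 1}" unfolding c'_def using cancel by (intro track_range)
  obtain i where i: "x = \<sigma> i" "i \<in> {1..n}" using cancel by auto
  have "p_val c' ([(x, e), (x, \<not> e)] @ v) = p_val c' v"
  proof -
    have "p_pos c' i \<in> {1..n + 1}" by (rule p_pos_range[OF c' i(2)])
    moreover have "p_val c' v \<in> carrier G" by (rule p_val_closed[OF cancel(2) c'])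
    ultimately show ?thesis
      using i c' cancel(2) by (cases e) (simp_all add: p_val_Cons flip: m_assoc)
  qed
  moreover have "track c' [(x, e), (x, \<not> e)] = c'" using i c' by simp
  ultimately show ?case
    using cancel p_val_append[of u "[(x, e), (x, \<not> e)] @ v" c] p_val_append[of u v c]
    by (simp add: c'_def del: append_Cons)
next
  case (relation u v r r')
  define c' where "c' = track c u"
  have c': "c' \<in> {1..n + 1}" unfolding c'_def using relation by (intro track_range)
  have "track c' r = track c' r' \<and> p_val c' r = p_val c' r'"
  proof -
    from relation(3) consider
      i where "1 \<le> i" "i + 1 \<le> n" "r = [pos (\<sigma> i), pos (\<sigma> (i + 1)), pos (\<sigma> i)]"
        "r' = [pos (\<sigma> (i + 1)), pos (\<sigma> i), pos (\<sigma> (i + 1))]"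
    | i j where "1 \<le> i" "i + 2 \<le> j" "j \<le> n" "r = [pos (\<sigma> i), pos (\<sigma> j)]" "r' = [pos (\<sigma> j), pos (\<sigma> i)]"
    | i j where "1 \<le> i" "i + 2 \<le> j" "j \<le> n" "r = [pos (\<sigma> j), pos (\<sigma> i)]" "r' = [pos (\<sigma> i), pos (\<sigma> j)]"
      unfolding braid_rels_def by auto
    then show ?thesis
    proof cases
      case 1
      have "p_val c' r = p_val c' r'"
        using p_val_braid[OF 1(1,2) c'] 1 c' by (simp add: p_val_Cons)
      moreover have "track c' r = track c' r'" using 1 by (auto simp: p_pos_def)
      ultimately show ?thesis by blast
    next
      case 2
      have "p_val c' r = p_val c' r'"
        using p_val_far[OF 2(1-3) c'] 2 c' by (simp add: p_val_Cons)
      moreover have "track c' r = track c' r'" using 2 by (auto simp: p_pos_def)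
      ultimately show ?thesis by blast
    next
      case 3
      have "p_val c' r = p_val c' r'"
        using p_val_far[OF 3(1-3) c'] 3 c' by (simp add: p_val_Cons)
      moreover have "track c' r = track c' r'" using 3 by (auto simp: p_pos_def)
      ultimately show ?thesis by blast
    qed
  qed
  moreover have "track c' r \<in> {1..n + 1}" "track c' r' \<in> {1..n + 1}"
    using track_range[OF relation(4) c'] track_range[OF relation(5) c'] by blast+
  ultimately show ?case
    using relation c' p_val_append[of u "r @ v" c] p_val_append[of u "r' @ v" c]
      p_val_append[of r v c'] p_val_append[of r' v c']
    by (simp add: c'_def)
qed auto

end

lemma (in cylindrical) val_relations:
  assumes "(r, r') \<in> braid_rels n \<union> cyl_rels n"
  shows "word_eval G val r = word_eval G val r'"
proof -
  from assms consider
    i where "1 \<le> i" "i + 1 \<le> n - 1" "r = [pos (\<sigma> i), pos (\<sigma> (i + 1)), pos (\<sigma> i)]"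
      "r' = [pos (\<sigma> (i + 1)), pos (\<sigma> i), pos (\<sigma> (i + 1))]"
  | i j where "i \<in> {1..n - 1}" "j \<in> {1..n - 1}" "i + 2 \<le> j \<or> j + 2 \<le> i"
      "r = [pos (\<sigma> i), pos (\<sigma> j)]" "r' = [pos (\<sigma> j), pos (\<sigma> i)]"
  | i where "1 \<le> i" "i \<le> n - 2" "r = [pos \<zeta>, pos (\<sigma> (i + 1)), neg \<zeta>]" "r' = [pos (\<sigma> i)]"
  | "r = [pos \<zeta>, pos \<zeta>, pos (\<sigma> 1), neg \<zeta>, neg \<zeta>]" "r' = [pos (\<sigma> (n - 1))]"
    unfolding braid_rels_def cyl_rels_def by blast
  then show ?thesis
  proof cases
    case 1
    then show ?thesis using s_braid[of i] by simp
  next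
    case 2
    then show ?thesis using s_far[of i j] by simp
  next
    case 3
    then show ?thesis using conj_eqI[of z "s (i + 1)" "s i"] z_shift[of i] by simp
  next
    case 4
    then show ?thesis using conj_twice_eqI[of z "s 1" "s (n - 1)"] z_wrap n by simp
  qed
qed

text \<open>More generators and more relations than those of the cylindrical braid group are allowed, in order
  to cover the virtual one as well.\<close>

lemma cylindrical_pres_group:
  assumes n: "3 \<le> n" and X: "cyl_gens n \<subseteq> X" and R: "braid_rels n \<union> cyl_rels n \<subseteq> R"
  shows "cylindrical (pres_group X R) n
    (\<lambda>i. word_class X R [pos (\<sigma> i)]) (word_class X R [pos \<zeta>])"
proof -
  interpret P: group "pres_group X R" by (rule group_pres_group)
  have \<zeta>: "\<zeta> \<in> X" and \<sigma>: "\<And>i. 1 \<le> i \<Longrightarrow> i \<le> n - 1 \<Longrightarrow> \<sigma> i \<in> X" using X by auto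
  note rel = word_eval_relation[OF subsetD[OF R], where X = X]
  show ?thesis
  proof unfold_locales
    fix i assume i: "1 \<le> i" "i + 1 \<le> n - 1"
    have "([pos (\<sigma> i), pos (\<sigma> (i + 1)), pos (\<sigma> i)], [pos (\<sigma> (i + 1)), pos (\<sigma> i), pos (\<sigma> (i + 1))])
        \<in> braid_rels n \<union> cyl_rels n"
      using i by (auto simp: braid_rels_def)
    from rel[OF this] show "word_class X R [pos (\<sigma> i)] \<otimes>\<^bsub>pres_group X R\<^esub>
        (word_class X R [pos (\<sigma> (i + 1))] \<otimes>\<^bsub>pres_group X R\<^esub> word_class X R [pos (\<sigma> i)]) =
        word_class X R [pos (\<sigma> (i + 1))] \<otimes>\<^bsub>pres_group X R\<^esub>
        (word_class X R [pos (\<sigma> i)] \<otimes>\<^bsub>pres_group X R\<^esub> word_class X R [pos (\<sigma> (i + 1))])"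
      using i \<sigma> by simp
  next
    fix i j assume i: "1 \<le> i" "i \<le> n - 1" "1 \<le> j" "j \<le> n - 1" "i + 2 \<le> j \<or> j + 2 \<le> i"
    have "([pos (\<sigma> i), pos (\<sigma> j)], [pos (\<sigma> j), pos (\<sigma> i)]) \<in> braid_rels n \<union> cyl_rels n"
      using i by (auto simp: braid_rels_def)
    from rel[OF this] show "word_class X R [pos (\<sigma> i)] \<otimes>\<^bsub>pres_group X R\<^esub> word_class X R [pos (\<sigma> j)] =
        word_class X R [pos (\<sigma> j)] \<otimes>\<^bsub>pres_group X R\<^esub> word_class X R [pos (\<sigma> i)]"
      using i \<sigma> by simp
  next
    fix i assume i: "1 \<le> i" "i \<le> n - 2"
    have "([pos \<zeta>, pos (\<sigma> (i + 1)), neg \<zeta>], [pos (\<sigma> i)]) \<in> braid_rels n \<union> cyl_rels n"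
      using i by (auto simp: cyl_rels_def)
    from rel[OF this] show "word_class X R [pos \<zeta>] \<otimes>\<^bsub>pres_group X R\<^esub> word_class X R [pos (\<sigma> (i + 1))] =
        word_class X R [pos (\<sigma> i)] \<otimes>\<^bsub>pres_group X R\<^esub> word_class X R [pos \<zeta>]"
      using i \<sigma> \<zeta> by (intro P.conj_eqD) simp_all
  next
    have "([pos \<zeta>, pos \<zeta>, pos (\<sigma> 1), neg \<zeta>, neg \<zeta>], [pos (\<sigma> (n - 1))])
        \<in> braid_rels n \<union> cyl_rels n"
      by (auto simp: cyl_rels_def)
    from rel[OF this] show "word_class X R [pos \<zeta>] \<otimes>\<^bsub>pres_group X R\<^esub> word_class X R [pos \<zeta>]
          \<otimes>\<^bsub>pres_group X R\<^esub> word_class X R [pos (\<sigma> 1)] =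
        word_class X R [pos (\<sigma> (n - 1))] \<otimes>\<^bsub>pres_group X R\<^esub>
          (word_class X R [pos \<zeta>] \<otimes>\<^bsub>pres_group X R\<^esub> word_class X R [pos \<zeta>])"
      using n \<sigma> \<zeta> by (intro P.conj_twice_eqD) simp_all
  qed (use n \<sigma> \<zeta> in simp_all)
qed

lemma p_map_class:
  assumes n: "3 \<le> n" and k: "k \<in> {1..n + 1}" and w: "w \<in> words (braid_gens (n + 1))"
    and pure: "B_class (n + 1) w \<in> carrier (PB (n + 1))"
  shows "p_map n k (B_class (n + 1) w) = CB_class n (p_word n k w)"
proof -
  interpret C: cylindrical "CB n" n "\<lambda>i. CB_class n [pos (\<sigma> i)]" "CB_class n [pos \<zeta>]"
    unfolding CB_def by (rule cylindrical_pres_group[OF n]) auto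
  have eq: "CB_class n (p_word n k v) = C.p_val k v" if "v \<in> words (braid_gens (n + 1))" for v
  proof -
    have "C.p_val k v = word_eval (CB n) (\<lambda>x. CB_class n [pos x]) (p_word n k v)"
      unfolding C.p_val_def by (rule C.word_eval_cong[OF C.p_word_words[OF that k]])
        (elim insertE imageE; simp only: C.val_simps)
    then show ?thesis
      using word_class_eq_word_eval[OF C.p_word_words[OF that k]] by (simp add: CB_def)
  qed
  have "the_elem ((\<lambda>w. CB_class n (p_word n k w)) ` B_class (n + 1) w) = CB_class n (p_word n k w)"
  proof (rule the_elem_image_word_class[OF w])
    fix v assume vw: "(w, v) \<in> pres_rel (braid_gens (n + 1)) (braid_rels (n + 1))"
    then show "CB_class n (p_word n k v) = CB_class n (p_word n k w)"
      using C.p_val_pres_rel[OF vw k] pres_rel_words[OF vw] eq by metis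
  qed
  then show ?thesis using pure by (simp add: p_map_def)
qed


section \<open>Coverings of the cylinder\<close>

text \<open>The virtual crossings satisfy the same cylindrical relations as the real ones, so the results on
  products of consecutive crossings hold for both, and for virtual ones moved past real ones.\<close>

locale virtual_cylindrical = cylindrical +
  fixes t :: "nat \<Rightarrow> 'a"
  assumes t_closed [simp]: "1 \<le> i \<Longrightarrow> i \<le> n - 1 \<Longrightarrow> t i \<in> carrier G"
    and t_square: "1 \<le> i \<Longrightarrow> i \<le> n - 1 \<Longrightarrow> t i \<otimes> t i = \<one>"
    and t_braid: "1 \<le> i \<Longrightarrow> i + 1 \<le> n - 1 \<Longrightarrow>
      t i \<otimes> (t (i + 1) \<otimes> t i) = t (i + 1) \<otimes> (t i \<otimes> t (i + 1))"
    and t_far: "1 \<le> i \<Longrightarrow> i \<le> n - 1 \<Longrightarrow> 1 \<le> j \<Longrightarrow> j \<le> n - 1 \<Longrightarrow> i + 2 \<le> j \<or> j + 2 \<le> i \<Longrightarrow>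
      t i \<otimes> t j = t j \<otimes> t i"
    and s_t_far: "1 \<le> i \<Longrightarrow> i \<le> n - 1 \<Longrightarrow> 1 \<le> j \<Longrightarrow> j \<le> n - 1 \<Longrightarrow> i + 2 \<le> j \<or> j + 2 \<le> i \<Longrightarrow>
      s i \<otimes> t j = t j \<otimes> s i"
    and t_t_s: "1 \<le> i \<Longrightarrow> i + 1 \<le> n - 1 \<Longrightarrow>
      t i \<otimes> (t (i + 1) \<otimes> s i) = s (i + 1) \<otimes> (t i \<otimes> t (i + 1))"
    and z_t_shift: "1 \<le> i \<Longrightarrow> i \<le> n - 2 \<Longrightarrow> z \<otimes> t (i + 1) = t i \<otimes> z"
    and z_t_wrap: "z \<otimes> z \<otimes> t 1 = t (n - 1) \<otimes> (z \<otimes> z)"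
begin

sublocale T: cylindrical G n t z
  by unfold_locales (use n t_braid t_far z_t_shift z_t_wrap in auto)

sublocale TS: sliding G t s "n - 1"
proof unfold_locales
  fix i assume i: "1 \<le> i" "i < n - 1"
  show "t i \<otimes> (t (i + 1) \<otimes> s i) = s (i + 1) \<otimes> (t i \<otimes> t (i + 1))"
    using t_t_s[of i] i by simp
  \<comment> \<open>The same relation read backwards, since the virtual crossings are involutions.\<close>
  then have "inv (t i \<otimes> t (i + 1)) \<otimes> s (i + 1) = s i \<otimes> inv (t i \<otimes> t (i + 1))"
    using i by (intro inverse_intertwine) (simp_all add: m_assoc)
  moreover have "inv (t i \<otimes> t (i + 1)) = t (i + 1) \<otimes> t i"
    using i t_square[of i] t_square[of "i + 1"] inv_equality[of "t i" "t i"]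
      inv_equality[of "t (i + 1)" "t (i + 1)"] by (simp add: inv_mult_group)
  ultimately show "t (i + 1) \<otimes> (t i \<otimes> s (i + 1)) = s i \<otimes> (t (i + 1) \<otimes> t i)"
    using i by (simp add: m_assoc)
next
  show "t 1 \<otimes> (t 1 \<otimes> s 1) = s 1 \<otimes> (t 1 \<otimes> t 1)"
    using n t_square[of 1] m_assoc[of "t 1" "t 1" "s 1"] by simp
qed (use t_braid t_far s_t_far in auto)

text \<open>One strand moves once around the cylinder, meeting the others in virtual crossings only. The map
  induced by \<open>z \<mapsto> z\<^sup>d\<close> inserts \<open>d - 1\<close> such loops.\<close>

definition loop :: 'a where "loop = T.\<Delta> \<otimes> z"

lemma loop_closed [simp]: "loop \<in> carrier G"
  by (simp add: loop_def)

lemma s_loop: "1 \<le> i \<Longrightarrow> i \<le> n - 2 \<Longrightarrow> s (i + 1) \<otimes> loop = loop \<otimes> s (i + 1)"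
proof -
  assume i: "1 \<le> i" "i \<le> n - 2"
  have "loop \<otimes> s (i + 1) = T.\<Delta> \<otimes> s i \<otimes> z"
    using i z_shift[of i] by (simp add: loop_def m_assoc)
  also have "\<dots> = s (i + 1) \<otimes> loop"
    using i TS.coxeter_shift[of "n - 1" i] by (simp add: loop_def m_assoc)
  finally show ?thesis by simp
qed

text \<open>The same loop for the neighbouring strand; by \<open>z_loop2\<close> it arises when a loop is carried across
  the rotation.\<close>

definition loop2 :: 'a where "loop2 = t 1 \<otimes> (loop \<otimes> t 1)"

lemma t1_closed [simp]: "t (Suc 0) \<in> carrier G"
  using n t_closed[of 1] by simp

lemma t1_t1 [simp]: "x \<in> carrier G \<Longrightarrow> t (Suc 0) \<otimes> (t (Suc 0) \<otimes> x) = x"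
  using n t_square[of 1] m_assoc[of "t 1" "t 1" x] by simp

lemma loop2_closed [simp]: "loop2 \<in> carrier G"
  by (simp add: loop2_def)

lemma z_loop2: "z \<otimes> loop2 = loop \<otimes> z"
proof -
  define c where "c = coxeter t (n - 2)"
  define c' where "c' = coxeter (\<lambda>i. t (i + 1)) (n - 2)"
  have n1: "n - 1 = Suc (n - 2)" using n by simp
  have [simp]: "c \<in> carrier G" "c' \<in> carrier G"
    unfolding c_def c'_def using n by (auto intro!: coxeter_closed)
  have [simp]: "t (n - Suc 0) \<in> carrier G" using n by simp
  have c: "T.\<Delta> = c \<otimes> t (n - 1)" unfolding c_def n1 by simp
  have c': "T.\<Delta> = t 1 \<otimes> c'" unfolding c'_def n1 by (rule T.coxeter_split_first) (use n in simp)
  have "c' \<otimes> inv z = inv z \<otimes> c"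
    unfolding c_def c'_def using T.z_inv_coxeter[of "n - 2"] n by simp
  from inverse_intertwine[of "inv z" c c'] this have zc: "z \<otimes> c' = c \<otimes> z" by simp
  have "z \<otimes> loop2 = (z \<otimes> c') \<otimes> (z \<otimes> t 1)"
    unfolding loop2_def loop_def c' by (simp add: m_assoc)
  also have "\<dots> = c \<otimes> (z \<otimes> z \<otimes> t 1)" unfolding zc by (simp add: m_assoc)
  also have "\<dots> = loop \<otimes> z" unfolding z_t_wrap loop_def c by (simp add: m_assoc)
  finally show ?thesis .
qed

text \<open>Two neighbouring strands move around the cylinder together. This does not affect their crossing:
  \<open>z \<otimes> z\<close> carries it to the far end and the square of the virtual product carries it back.\<close>

definition double_loop :: 'a where "double_loop = T.\<Delta> \<otimes> T.\<Delta> \<otimes> (z \<otimes> z)"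

lemma loop_loop2: "loop \<otimes> loop2 = double_loop"
proof -
  have "loop \<otimes> loop2 = T.\<Delta> \<otimes> (z \<otimes> loop2)" unfolding loop_def by (simp add: m_assoc)
  also have "\<dots> = double_loop" unfolding z_loop2 loop_def double_loop_def by (simp add: m_assoc)
  finally show ?thesis .
qed

lemma double_loop_closed [simp]: "double_loop \<in> carrier G"
  by (simp add: double_loop_def)

lemma double_loop_commute:
  assumes "x \<in> carrier G" "x' \<in> carrier G"
    and "z \<otimes> z \<otimes> x = x' \<otimes> (z \<otimes> z)" "T.\<Delta> \<otimes> T.\<Delta> \<otimes> x' = x \<otimes> (T.\<Delta> \<otimes> T.\<Delta>)"
  shows "double_loop \<otimes> x = x \<otimes> double_loop"
proof -
  have "double_loop \<otimes> x = T.\<Delta> \<otimes> T.\<Delta> \<otimes> (z \<otimes> z \<otimes> x)"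
    using assms(1) by (simp add: double_loop_def m_assoc)
  also have "\<dots> = (T.\<Delta> \<otimes> T.\<Delta> \<otimes> x') \<otimes> (z \<otimes> z)"
    unfolding assms(3) using assms(2) by (simp add: m_assoc)
  also have "\<dots> = x \<otimes> double_loop"
    unfolding assms(4) using assms(1) by (simp add: double_loop_def m_assoc)
  finally show ?thesis .
qed

lemma double_loop_s: "double_loop \<otimes> s 1 = s 1 \<otimes> double_loop"
  using n z_wrap TS.coxeter_square_shift[of "n - 1"]
  by (intro double_loop_commute[of _ "s (n - 1)"]) simp_all

lemma double_loop_t: "double_loop \<otimes> t 1 = t 1 \<otimes> double_loop"
  using n z_t_wrap T.coxeter_square_shift[of "n - 1"]
  by (intro double_loop_commute[of _ "t (n - 1)"]) simp_all

lemma loop2_loop: "loop2 \<otimes> loop = double_loop"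
proof -
  have "loop2 \<otimes> loop = t 1 \<otimes> (loop \<otimes> loop2) \<otimes> t 1"
    using t_square[of 1] n by (simp add: loop2_def m_assoc)
  also have "\<dots> = double_loop"
    unfolding loop_loop2 double_loop_t[symmetric] using t_square[of 1] n
    by (simp add: m_assoc)
  finally show ?thesis .
qed

text \<open>The loop does not meet the crossings \<open>s (i + 1)\<close>, so the shift relations persist. In the wrap
  relation the two rotations leave loops around two neighbouring strands, which commute, and their
  product \<open>double_loop\<close> commutes with \<open>s 1\<close>.\<close>

lemma cylindrical_cover: "cylindrical G n s (z \<otimes> loop [^] (m :: int))"
proof unfold_locales
  show "z \<otimes> loop [^] m \<in> carrier G" by simp
  fix i assume i: "1 \<le> i" "i \<le> n - 2"
  have "s (i + 1) \<otimes> loop [^] m = loop [^] m \<otimes> s (i + 1)"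
    using i by (intro intertwine_int_pow s_loop) simp_all
  then have "z \<otimes> loop [^] m \<otimes> s (i + 1) = z \<otimes> s (i + 1) \<otimes> loop [^] m"
    using i by (simp add: m_assoc)
  also have "\<dots> = s i \<otimes> (z \<otimes> loop [^] m)"
    unfolding z_shift[OF i] using i by (simp add: m_assoc)
  finally show "z \<otimes> loop [^] m \<otimes> s (i + 1) = s i \<otimes> (z \<otimes> loop [^] m)" .
next
  have 1: "s 1 \<in> carrier G" "s (n - 1) \<in> carrier G" using n by simp_all
  have "z \<otimes> loop2 [^] m = loop [^] m \<otimes> z"
    by (intro intertwine_int_pow z_loop2) simp_all
  then have "z \<otimes> loop [^] m \<otimes> (z \<otimes> loop [^] m) = z \<otimes> z \<otimes> (loop2 [^] m \<otimes> loop [^] m)"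
    by (metis (no_types) int_pow_closed loop2_closed loop_closed m_assoc m_closed z_closed)
  also have "loop2 [^] m \<otimes> loop [^] m = double_loop [^] m"
    using int_pow_mult_distrib[of loop2 loop m] by (simp add: loop_loop2 loop2_loop)
  finally have zz: "z \<otimes> loop [^] m \<otimes> (z \<otimes> loop [^] m) = z \<otimes> z \<otimes> double_loop [^] m" .
  have "s 1 \<otimes> double_loop [^] m = double_loop [^] m \<otimes> s 1"
    using 1 double_loop_s by (intro intertwine_int_pow) simp_all
  then have "z \<otimes> z \<otimes> double_loop [^] m \<otimes> s 1 = z \<otimes> z \<otimes> s 1 \<otimes> double_loop [^] m"
    using 1 by (simp add: m_assoc)
  also have "\<dots> = s (n - 1) \<otimes> (z \<otimes> z \<otimes> double_loop [^] m)"
    unfolding z_wrap using 1 by (simp add: m_assoc)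
  finally show "z \<otimes> loop [^] m \<otimes> (z \<otimes> loop [^] m) \<otimes> s 1 =
      s (n - 1) \<otimes> (z \<otimes> loop [^] m \<otimes> (z \<otimes> loop [^] m))"
    unfolding zz .
qed (use n s_braid s_far in auto)

end

lemma virtual_cylindrical_VCB:
  assumes n: "3 \<le> n"
  shows "virtual_cylindrical (VCB n) n
    (\<lambda>i. VCB_class n [pos (\<sigma> i)]) (VCB_class n [pos \<zeta>]) (\<lambda>i. VCB_class n [pos (\<tau> i)])"
proof -
  define X where "X = virtual_gens n"
  define R where "R = braid_rels n \<union> cyl_rels n \<union> virtual_rels n"
  have VCB: "VCB n = pres_group X R" by (simp add: VCB_def X_def R_def)
  have R': "(r, r') \<in> R" if "(r, r') \<in> virtual_rels n" for r r'
    using that by (simp add: R_def)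
  interpret P: group "pres_group X R" by (rule group_pres_group)
  interpret C: cylindrical "pres_group X R" n
    "\<lambda>i. word_class X R [pos (\<sigma> i)]" "word_class X R [pos \<zeta>]"
    by (rule cylindrical_pres_group[OF n]) (auto simp: X_def R_def)
  have \<zeta>: "\<zeta> \<in> X" and \<sigma>: "\<And>i. 1 \<le> i \<Longrightarrow> i \<le> n - 1 \<Longrightarrow> \<sigma> i \<in> X"
    and \<tau>: "\<And>i. 1 \<le> i \<Longrightarrow> i \<le> n - 1 \<Longrightarrow> \<tau> i \<in> X" by (auto simp: X_def)
  note rel = word_eval_relation[OF R', where X = X]
  let ?G = "pres_group X R"
  let ?s = "\<lambda>i. word_class X R [pos (\<sigma> i)]"
  let ?t = "\<lambda>i. word_class X R [pos (\<tau> i)]"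
  let ?z = "word_class X R [pos \<zeta>]"
  have "virtual_cylindrical ?G n ?s ?z ?t"
  proof unfold_locales
    fix i assume i: "1 \<le> i" "i \<le> n - 1"
    have "([pos (\<tau> i), pos (\<tau> i)], []) \<in> virtual_rels n"
      using i by (auto simp: virtual_rels_def)
    from rel[OF this] show "?t i \<otimes>\<^bsub>?G\<^esub> ?t i = \<one>\<^bsub>?G\<^esub>"
      using i \<tau> by simp
  next
    fix i assume i: "1 \<le> i" "i + 1 \<le> n - 1"
    have "([pos (\<tau> i), pos (\<tau> (i + 1)), pos (\<tau> i)], [pos (\<tau> (i + 1)), pos (\<tau> i), pos (\<tau> (i + 1))])
        \<in> virtual_rels n"
      using i by (auto simp: virtual_rels_def)
    from rel[OF this] show "?t i \<otimes>\<^bsub>?G\<^esub> (?t (i + 1) \<otimes>\<^bsub>?G\<^esub> ?t i) =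
        ?t (i + 1) \<otimes>\<^bsub>?G\<^esub> (?t i \<otimes>\<^bsub>?G\<^esub> ?t (i + 1))"
      using i \<tau> by simp
    have "([pos (\<tau> i), pos (\<tau> (i + 1)), pos (\<sigma> i)], [pos (\<sigma> (i + 1)), pos (\<tau> i), pos (\<tau> (i + 1))])
        \<in> virtual_rels n"
      using i by (auto simp: virtual_rels_def)
    from rel[OF this] show "?t i \<otimes>\<^bsub>?G\<^esub> (?t (i + 1) \<otimes>\<^bsub>?G\<^esub> ?s i) =
        ?s (i + 1) \<otimes>\<^bsub>?G\<^esub> (?t i \<otimes>\<^bsub>?G\<^esub> ?t (i + 1))"
      using i \<tau> \<sigma> by simp
  next
    fix i j assume i: "1 \<le> i" "i \<le> n - 1" "1 \<le> j" "j \<le> n - 1" "i + 2 \<le> j \<or> j + 2 \<le> i"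
    have "([pos (\<tau> i), pos (\<tau> j)], [pos (\<tau> j), pos (\<tau> i)]) \<in> virtual_rels n"
      using i by (auto simp: virtual_rels_def)
    from rel[OF this] show "?t i \<otimes>\<^bsub>?G\<^esub> ?t j = ?t j \<otimes>\<^bsub>?G\<^esub> ?t i"
      using i \<tau> by simp
    have "([pos (\<sigma> i), pos (\<tau> j)], [pos (\<tau> j), pos (\<sigma> i)]) \<in> virtual_rels n"
      using i by (auto simp: virtual_rels_def)
    from rel[OF this] show "?s i \<otimes>\<^bsub>?G\<^esub> ?t j = ?t j \<otimes>\<^bsub>?G\<^esub> ?s i"
      using i \<tau> \<sigma> by simp
  next
    fix i assume i: "1 \<le> i" "i \<le> n - 2"
    have "([pos \<zeta>, pos (\<tau> (i + 1)), neg \<zeta>], [pos (\<tau> i)]) \<in> virtual_rels n"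
      using i by (auto simp: virtual_rels_def)
    from rel[OF this] show "?z \<otimes>\<^bsub>?G\<^esub> ?t (i + 1) = ?t i \<otimes>\<^bsub>?G\<^esub> ?z"
      using i \<tau> \<zeta> by (intro P.conj_eqD) simp_all
  next
    have "([pos \<zeta>, pos \<zeta>, pos (\<tau> 1), neg \<zeta>, neg \<zeta>], [pos (\<tau> (n - 1))]) \<in> virtual_rels n"
      by (auto simp: virtual_rels_def)
    from rel[OF this] show "?z \<otimes>\<^bsub>?G\<^esub> ?z \<otimes>\<^bsub>?G\<^esub> ?t 1 = ?t (n - 1) \<otimes>\<^bsub>?G\<^esub> (?z \<otimes>\<^bsub>?G\<^esub> ?z)"
      using n \<tau> \<zeta> by (intro P.conj_twice_eqD) simp_all
  qed (use \<tau> in simp_all)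
  then show ?thesis by (simp add: VCB X_def R_def)
qed

lemma cyl_rels_words:
  assumes "3 \<le> n" "(r, r') \<in> braid_rels n \<union> cyl_rels n"
  shows "r \<in> words (cyl_gens n)" "r' \<in> words (cyl_gens n)"
  using assms by (auto simp: braid_rels_def cyl_rels_def intro!: imageI)

lemma f_map_class:
  assumes n: "3 \<le> n" and w: "w \<in> words (\<sigma> ` {1..n - 1})"
    and pure: "CB_class n w \<in> carrier (CPB n)"
  shows "f_map n d (CB_class n w) = VCB_class n w"
proof -
  interpret V: virtual_cylindrical "VCB n" n
    "\<lambda>i. VCB_class n [pos (\<sigma> i)]" "VCB_class n [pos \<zeta>]" "\<lambda>i. VCB_class n [pos (\<tau> i)]"
    by (rule virtual_cylindrical_VCB[OF n])
  define z' where "z' = VCB_class n [pos \<zeta>] \<otimes>\<^bsub>VCB n\<^esub> V.loop [^]\<^bsub>VCB n\<^esub> (d - 1)"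
  interpret F: cylindrical "VCB n" n "\<lambda>i. VCB_class n [pos (\<sigma> i)]" z'
    unfolding z'_def by (rule V.cylindrical_cover)
  have "\<tau> i \<in> virtual_gens n" if "1 \<le> i" "i < n" for i
  proof -
    have "i \<in> {1..n - 1}" using that by simp
    then show ?thesis by blast
  qed
  then have "map (\<lambda>i. pos (\<tau> i)) [1..<n] \<in> words (virtual_gens n)"
    by (force simp: words_def)
  moreover have "[1..<Suc (n - 1)] = [1..<n]" using n by simp
  ultimately have "\<Delta>v n =
      word_eval (VCB n) (\<lambda>x. VCB_class n [pos x]) (map (\<lambda>i. pos (\<tau> i)) [1..<Suc (n - 1)])"
    unfolding \<Delta>v_def VCB_def by (simp only: word_class_eq_word_eval)
  also have "\<dots> = V.coxeter (\<lambda>i. VCB_class n [pos (\<tau> i)]) (n - 1)"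
    by (rule V.word_eval_consecutive) (rule V.t_closed)
  finally have \<Delta>v: "\<Delta>v n = \<dots>" .
  have f: "f_gen n d x = F.val x" if x: "x \<in> cyl_gens n" for x
  proof (cases "x = \<zeta>")
    case True
    then have "F.val x = z'" by (simp only: F.val_simps)
    moreover have "f_gen n d \<zeta> = z'"
      by (simp only: f_gen_def VCB_gen_def z'_def V.loop_def \<Delta>v simp_thms if_True)
    ultimately show ?thesis using True by (simp only:)
  next
    case False
    then obtain i where i: "x = \<sigma> i" using x by blast
    then have "F.val x = VCB_class n [pos (\<sigma> i)]" by (simp only: F.val_simps)
    then show ?thesis unfolding i by (simp only: f_gen_def VCB_gen_def gen.distinct if_False)
  qed
  have f_closed: "f_gen n d ` cyl_gens n \<subseteq> carrier (VCB n)"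
  proof (rule image_subsetI)
    fix x assume x: "x \<in> cyl_gens n"
    show "f_gen n d x \<in> carrier (VCB n)"
      unfolding f[OF x] by (rule subsetD[OF F.val_closed imageI[OF x]])
  qed
  have eval: "word_eval (VCB n) (f_gen n d) v = word_eval (VCB n) F.val v"
    if "v \<in> words (cyl_gens n)" for v
    by (rule V.word_eval_cong[OF that f])
  have "pres_lift (VCB n) (f_gen n d) (CB_class n w) = word_eval (VCB n) (f_gen n d) w"
  proof (rule V.pres_lift_word_class[OF f_closed])
    fix r r' assume r: "(r, r') \<in> braid_rels n \<union> cyl_rels n"
    show "word_eval (VCB n) (f_gen n d) r = word_eval (VCB n) (f_gen n d) r'"
      \<comment> \<open>The plain name \<open>trans\<close> would denote an introduction rule of \<open>pres_rel\<close>.\<close>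
      by (rule HOL.trans[OF eval[OF cyl_rels_words(1)[OF n r]]
        HOL.trans[OF F.val_relations[OF r] eval[OF cyl_rels_words(2)[OF n r], symmetric]]])
  qed (rule words_mono[OF w], auto)
  also have "\<dots> = word_eval (VCB n) (\<lambda>x. VCB_class n [pos x]) w"
    by (rule V.word_eval_cong[OF w]) (auto simp: f_gen_def VCB_gen_def)
  also have "\<dots> = VCB_class n w"
    unfolding VCB_def by (rule word_class_eq_word_eval[symmetric]) (rule words_mono[OF w], auto)
  finally show ?thesis using pure by (simp add: f_map_def)
qed

section \<open>Rack colourings\<close>

text \<open>At a crossing one strand keeps its colour \<open>a\<close> and the other changes from \<open>b\<close> to \<open>op a b\<close>;
  self-distributivity is what the braid relation requires. Both the Burau representation and the
  colourings that detect the commutator are of this kind.\<close>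

locale rack =
  fixes op co :: "'a \<Rightarrow> 'a \<Rightarrow> 'a"
  assumes op_co [simp]: "op a (co a b) = b"
    and co_op [simp]: "co a (op a b) = b"
    and self_distrib: "op a (op b c) = op (op a b) (op a c)"
begin

definition cross :: "nat \<Rightarrow> (nat \<Rightarrow> 'a) \<Rightarrow> nat \<Rightarrow> 'a" where
  "cross i f = f(i := op (f i) (f (i + 1)), i + 1 := f i)"

definition uncross :: "nat \<Rightarrow> (nat \<Rightarrow> 'a) \<Rightarrow> nat \<Rightarrow> 'a" where
  "uncross i f = f(i := f (i + 1), i + 1 := co (f (i + 1)) (f i))"

lemma uncross_cross [simp]: "uncross i (cross i f) = f"
  and cross_uncross [simp]: "cross i (uncross i f) = f"
  by (auto simp: cross_def uncross_def fun_eq_iff)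

lemma cross_braid: "cross i (cross (i + 1) (cross i f)) = cross (i + 1) (cross i (cross (i + 1) f))"
  using self_distrib[of "f i" "f (i + 1)" "f (i + 2)"] by (auto simp: cross_def fun_eq_iff)

lemma cross_far:
  "i + 2 \<le> j \<or> j + 2 \<le> i \<Longrightarrow> cross i (cross j f) = cross j (cross i f)"
  by (auto simp: cross_def fun_eq_iff)

definition strand :: "nat \<times> bool \<Rightarrow> (nat \<Rightarrow> 'a) \<Rightarrow> nat \<Rightarrow> 'a" where
  "strand l = (if snd l then cross (fst l) else uncross (fst l))"

lemma strand_simps [simp]: "strand (i, True) = cross i" "strand (i, False) = uncross i"
  by (simp_all add: strand_def)

end

text \<open>The rack whose colourings carry the Burau representation, over any ring with a unit \<open>t\<close>.\<close>

locale alexander =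
  fixes t u :: "'a :: comm_ring_1"
  assumes t_u: "t * u = 1"
begin

sublocale rack "\<lambda>a b. (1 - t) * a + t * b" "\<lambda>a b. u * (b - (1 - t) * a)"
proof
  fix a b c :: 'a
  have "t * (u * x) = x" for x using mult.assoc[of t u x] t_u by simp
  moreover have "u * (t * x) = x" for x using mult.assoc[of u t x] t_u by (simp add: mult.commute)
  ultimately show "(1 - t) * a + t * (u * (b - (1 - t) * a)) = b"
    "u * (((1 - t) * a + t * b) - (1 - t) * a) = b" by simp_all
  show "(1 - t) * a + t * ((1 - t) * b + t * c) =
      (1 - t) * ((1 - t) * a + t * b) + t * ((1 - t) * a + t * c)"
    by (simp add: algebra_simps)
qed

end


section \<open>The matrix representation\<close>

definition tL_inv :: laurent where "tL_inv = Poly_Mapping.single (-1, 0) 1"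

lemma tL_tL_inv: "tL * tL_inv = 1"
  by (simp add: tL_def tL_inv_def mult_single zero_prod_def flip: single_one)

lemma sL_sL_inv: "sL * sL_inv = 1"
  by (simp add: sL_def sL_inv_def mult_single zero_prod_def flip: single_one)

interpretation L: alexander tL tL_inv
  by unfold_locales (rule tL_tL_inv)

text \<open>Column vectors are read as functions on the positions \<open>1, \<dots>, n\<close>.\<close>

definition coords :: "nat \<Rightarrow> (nat \<Rightarrow> laurent) \<Rightarrow> laurent vec" where
  "coords n f = vec n (\<lambda>j. f (Suc j))"

definition bump :: "nat \<Rightarrow> nat \<Rightarrow> laurent" where
  "bump b j = (if j = Suc b then 1 else 0)"

text \<open>The relations are verified for functions instead of matrices; \<open>\<rho>_word_coords\<close> transports them.\<close>

fun gen_act :: "nat \<Rightarrow> gen \<times> bool \<Rightarrow> (nat \<Rightarrow> laurent) \<Rightarrow> nat \<Rightarrow> laurent" where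
  "gen_act n (\<sigma> i, e) f = L.strand (i, e) f"
| "gen_act n (\<tau> i, e) f = f(i := sL * f (i + 1), i + 1 := sL_inv * f i)"
| "gen_act n (\<zeta>, True) f = (\<lambda>j. if j = n then f 1 else if 1 \<le> j \<and> j < n then f (j + 1) else f j)"
| "gen_act n (\<zeta>, False) f = (\<lambda>j. if j = 1 then f n else if 1 < j \<and> j \<le> n then f (j - 1) else f j)"

definition act_mat :: "nat \<Rightarrow> gen \<times> bool \<Rightarrow> laurent mat" where
  "act_mat n l = mat n n (\<lambda>(a, b). gen_act n l (bump b) (Suc a))"

lemma gen_act_cancel:
  "2 \<le> n \<Longrightarrow> gen_act n (x, e) (gen_act n (x, \<not> e) f) = f"
proof (cases x)
  case (\<tau> i)
  have "sL * (sL_inv * y) = y" "sL_inv * (sL * y) = y" for y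
    using sL_sL_inv mult.assoc[of sL sL_inv y] mult.assoc[of sL_inv sL y]
    by (simp_all add: mult.commute)
  then show ?thesis by (auto simp: \<tau> fun_eq_iff)
next
  case \<zeta>
  then show "2 \<le> n \<Longrightarrow> ?thesis" by (cases e) (auto simp: fun_eq_iff)
qed (cases e; simp)

lemma sum_bump:
  assumes "1 \<le> p" "p \<le> n"
  shows "(\<Sum>b = 0..<n. bump b p * f (Suc b)) = f p"
proof -
  have "(\<Sum>b = 0..<n. bump b p * f (Suc b)) = (\<Sum>b\<in>{p - 1}. bump b p * f (Suc b))"
    by (rule sum.mono_neutral_right) (use assms in \<open>auto simp: bump_def\<close>)
  then show ?thesis using assms by (simp add: bump_def)
qed

text \<open>A generator acts linearly on coordinates: this identifies its action with that of the matrix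
  whose columns are the images of the basis.\<close>

lemma gen_act_linear:
  assumes n: "2 \<le> n" and x: "x \<in> virtual_gens n" and a: "a < n"
  shows "(\<Sum>b = 0..<n. gen_act n (x, e) (bump b) (Suc a) * f (Suc b)) = gen_act n (x, e) f (Suc a)"
proof -
  have sum_bump_scaled: "(\<Sum>b = 0..<n. c * bump b p * f (Suc b)) = c * f p"
    if "1 \<le> p" "p \<le> n" for c p
    using sum_bump[OF that, of f] by (simp add: mult.assoc flip: sum_distrib_left)
  have sum_bump2: "(\<Sum>b = 0..<n. (c * bump b p + c' * bump b q) * f (Suc b)) = c * f p + c' * f q"
    if "1 \<le> p" "p \<le> n" "1 \<le> q" "q \<le> n" for c c' p q
    using that by (simp add: distrib_right sum.distrib sum_bump_scaled)
  have sum_bump3: "(\<Sum>b = 0..<n. u * (bump b p - c' * bump b q) * f (Suc b)) = u * (f p - c' * f q)"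
    if "1 \<le> p" "p \<le> n" "1 \<le> q" "q \<le> n" for u c' p q
    using sum_bump2[OF that, of u "- (u * c')"] by (simp add: algebra_simps)
  from x consider i where "x = \<sigma> i" "1 \<le> i" "i \<le> n - 1" | i where "x = \<tau> i" "1 \<le> i" "i \<le> n - 1" | "x = \<zeta>"
    by auto
  then show ?thesis
  proof cases
    case 1
    consider "Suc a = i" | "a = i" | "Suc a \<noteq> i" "a \<noteq> i" by blast
    then show ?thesis
      using 1 n a sum_bump[of "Suc a" n f]
      by cases (cases e; auto simp: L.cross_def L.uncross_def sum_bump sum_bump2 sum_bump3)+
  next
    case 2
    consider "Suc a = i" | "a = i" | "Suc a \<noteq> i" "a \<noteq> i" by blast
    then show ?thesis
      using 2 n a sum_bump[of "Suc a" n f] by cases (auto simp: sum_bump_scaled)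
  next
    case 3
    then show ?thesis using n a by (cases e) (auto simp: sum_bump)
  qed
qed

lemma act_mat_carrier [simp]: "act_mat n l \<in> carrier_mat n n"
  by (simp add: act_mat_def)

lemma act_mat_coords:
  assumes "2 \<le> n" "x \<in> virtual_gens n"
  shows "act_mat n (x, e) *\<^sub>v coords n f = coords n (gen_act n (x, e) f)"
  by (rule eq_vecI)
    (simp_all add: act_mat_def coords_def scalar_prod_def gen_act_linear[OF assms])

lemma diag_block_mat_index:
  assumes B: "B \<in> carrier_mat 2 2" and ab: "a < Suc (Suc (i + r))" "b < Suc (Suc (i + r))"
  shows "diag_block_mat [1\<^sub>m i, B, 1\<^sub>m r] $$ (a, b) =
    (if i \<le> a \<and> a \<le> i + 1 \<and> i \<le> b \<and> b \<le> i + 1 then B $$ (a - i, b - i)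
     else if a = b then 1 else 0 :: 'a :: {zero, one})"
proof -
  have dims [simp]: "dim_row B = 2" "dim_col B = 2" using B by auto
  consider "a < i" | "i \<le> a" "a \<le> i + 1" | "i + 2 \<le> a" by linarith
  then show ?thesis
    using ab by cases (auto simp: Let_def)
qed

lemma \<rho>_gen_act_mat:
  assumes "2 \<le> n" "x \<in> virtual_gens n"
  shows "\<rho>_gen n x = act_mat n (x, True)"
proof -
  from assms consider i r where "x = \<sigma> (Suc i)" "n = Suc (Suc (i + r))"
    | i r where "x = \<tau> (Suc i)" "n = Suc (Suc (i + r))" | "x = \<zeta>"
  proof -
    have "\<exists>i r. j = Suc i \<and> n = Suc (Suc (i + r))" if "j \<in> {1..n - 1}" for j
      using that assms(1) by (intro exI[of _ "j - 1"] exI[of _ "n - 1 - j"]) auto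
    then show ?thesis using assms(2) that by blast
  qed
  then show ?thesis
  proof cases
    case 1
    define B where "B = mat_of_rows_list 2 [[1 - tL, tL], [1, 0]]"
    have B: "B \<in> carrier_mat 2 2" "B $$ (0, 0) = 1 - tL" "B $$ (0, Suc 0) = tL"
      "B $$ (Suc 0, 0) = 1" "B $$ (Suc 0, Suc 0) = 0"
      by (auto simp: B_def mat_of_rows_list_def)
    have \<rho>: "\<rho>_gen n x = diag_block_mat [1\<^sub>m i, B, 1\<^sub>m r]" using 1 by (simp add: B_def)
    show ?thesis
    proof (rule eq_matI)
      fix a b assume "a < dim_row (act_mat n (x, True))" "b < dim_col (act_mat n (x, True))"
      then have ab: "a < Suc (Suc (i + r))" "b < Suc (Suc (i + r))" using 1 by (simp_all add: act_mat_def)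
      consider "a = i" | "a = Suc i" | "a \<noteq> i" "a \<noteq> Suc i" by blast
      then show "\<rho>_gen n x $$ (a, b) = act_mat n (x, True) $$ (a, b)"
        unfolding \<rho> diag_block_mat_index[OF B(1) ab]
        using ab 1 by cases (auto simp: act_mat_def bump_def L.cross_def B le_Suc_eq)
    qed (unfold \<rho>, use 1 carrier_matD[OF B(1)] in \<open>simp_all add: act_mat_def Let_def\<close>)
  next
    case 2
    define B where "B = mat_of_rows_list 2 [[0, sL], [sL_inv, 0]]"
    have B: "B \<in> carrier_mat 2 2" "B $$ (0, 0) = 0" "B $$ (0, Suc 0) = sL"
      "B $$ (Suc 0, 0) = sL_inv" "B $$ (Suc 0, Suc 0) = 0"
      by (auto simp: B_def mat_of_rows_list_def)
    have \<rho>: "\<rho>_gen n x = diag_block_mat [1\<^sub>m i, B, 1\<^sub>m r]" using 2 by (simp add: B_def)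
    show ?thesis
    proof (rule eq_matI)
      fix a b assume "a < dim_row (act_mat n (x, True))" "b < dim_col (act_mat n (x, True))"
      then have ab: "a < Suc (Suc (i + r))" "b < Suc (Suc (i + r))" using 2 by (simp_all add: act_mat_def)
      consider "a = i" | "a = Suc i" | "a \<noteq> i" "a \<noteq> Suc i" by blast
      then show "\<rho>_gen n x $$ (a, b) = act_mat n (x, True) $$ (a, b)"
        unfolding \<rho> diag_block_mat_index[OF B(1) ab]
        using ab 2 by cases (auto simp: act_mat_def bump_def B le_Suc_eq)
    qed (unfold \<rho>, use 2 carrier_matD[OF B(1)] in \<open>simp_all add: act_mat_def Let_def\<close>)
  next
    case 3
    then show ?thesis using assms(1)
      by (intro eq_matI) (auto simp: act_mat_def bump_def)
  qed
qed

lemma mat_eq_by_coords: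
  assumes "A \<in> carrier_mat n n" "B \<in> carrier_mat n n"
    and "\<And>f. A *\<^sub>v coords n f = B *\<^sub>v coords n f"
  shows "A = B"
proof (rule eq_matI)
  fix i j assume ij: "i < dim_row B" "j < dim_col B"
  have unit: "coords n (bump j) = unit_vec n j"
    using ij assms(2) by (intro eq_vecI) (auto simp: coords_def bump_def)
  have col: "M *\<^sub>v unit_vec n j = col M j" if "M \<in> carrier_mat n n" for M :: "laurent mat"
    using col_mult2[OF that one_carrier_mat, of j] ij assms(2) that by simp
  have "col A j = col B j"
    using assms(3)[of "bump j"] unfolding unit col[OF assms(1)] col[OF assms(2)] .
  then show "A $$ (i, j) = B $$ (i, j)" using ij assms(1,2) by (metis carrier_matD index_col)
qed (use assms in auto)

lemma group_GL: "group (GL n)"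
proof -
  interpret R: ring "ring_mat TYPE(laurent) n ()" by (rule ring_mat)
  show ?thesis unfolding GL_def by (rule R.units_group)
qed

lemma carrier_GL: "A \<in> carrier (GL n) \<Longrightarrow> A \<in> carrier_mat n n"
  by (simp add: GL_def units_of_def Units_def ring_mat_simps)

lemma mult_GL: "A \<otimes>\<^bsub>GL n\<^esub> B = A * B" and one_GL: "\<one>\<^bsub>GL n\<^esub> = 1\<^sub>m n"
  by (simp_all add: GL_def units_of_def ring_mat_simps)

lemma act_mat_inverse:
  assumes "2 \<le> n" "x \<in> virtual_gens n"
  shows "act_mat n (x, e) * act_mat n (x, \<not> e) = 1\<^sub>m n"
proof (rule mat_eq_by_coords)
  fix f
  have "act_mat n (x, e) * act_mat n (x, \<not> e) *\<^sub>v coords n f =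
      act_mat n (x, e) *\<^sub>v (act_mat n (x, \<not> e) *\<^sub>v coords n f)"
    by (rule assoc_mult_mat_vec[OF act_mat_carrier act_mat_carrier]) (simp add: coords_def)
  also have "\<dots> = coords n f" using assms by (simp add: act_mat_coords gen_act_cancel)
  also have "\<dots> = 1\<^sub>m n *\<^sub>v coords n f" by (simp add: coords_def)
  finally show "act_mat n (x, e) * act_mat n (x, \<not> e) *\<^sub>v coords n f = 1\<^sub>m n *\<^sub>v coords n f" .
qed (use mult_carrier_mat[OF act_mat_carrier act_mat_carrier] in auto)

lemma act_mat_GL:
  assumes "2 \<le> n" "x \<in> virtual_gens n"
  shows "act_mat n (x, e) \<in> carrier (GL n)"
  using act_mat_inverse[OF assms, of e] act_mat_inverse[OF assms, of "\<not> e"]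
  by (auto simp: GL_def units_of_def Units_def ring_mat_simps intro!: bexI[of _ "act_mat n (x, \<not> e)"])

lemma \<rho>_gen_closed: "2 \<le> n \<Longrightarrow> \<rho>_gen n ` virtual_gens n \<subseteq> carrier (GL n)"
  by (rule image_subsetI) (simp only: \<rho>_gen_act_mat act_mat_GL)

lemma \<rho>_word_coords:
  assumes n: "2 \<le> n" and w: "w \<in> words (virtual_gens n)"
  shows "word_eval (GL n) (\<rho>_gen n) w *\<^sub>v coords n f = coords n (foldr (gen_act n) w f)"
proof -
  interpret GL: group "GL n" by (rule group_GL)
  show ?thesis using w
  proof (induction w)
    case Nil
    show ?case by (simp add: one_GL coords_def)
  next
    case (Cons a w)
    obtain x e where a: "a = (x, e)" by force
    with Cons.prems have x: "x \<in> virtual_gens n" and w: "w \<in> words (virtual_gens n)" by auto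
    have "inv\<^bsub>GL n\<^esub> act_mat n (x, True) = act_mat n (x, False)"
      using act_mat_inverse[OF n x, of False] act_mat_GL[OF n x]
      by (intro GL.inv_equality) (simp_all add: mult_GL one_GL)
    then have "word_eval (GL n) (\<rho>_gen n) (a # w) = act_mat n (x, e) * word_eval (GL n) (\<rho>_gen n) w"
      by (simp add: a \<rho>_gen_act_mat[OF n x] mult_GL)
    also have "\<dots> *\<^sub>v coords n f = act_mat n (x, e) *\<^sub>v (word_eval (GL n) (\<rho>_gen n) w *\<^sub>v coords n f)"
      using carrier_GL[OF GL.word_eval_closed[OF \<rho>_gen_closed[OF n] w]]
      by (rule assoc_mult_mat_vec[OF act_mat_carrier]) (simp add: coords_def)
    finally show ?case
      by (simp add: Cons.IH[OF w] act_mat_coords[OF n x] a)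
  qed
qed

lemma \<rho>_word_eqI:
  assumes n: "2 \<le> n" and "v \<in> words (virtual_gens n)" "w \<in> words (virtual_gens n)"
    and "\<And>f. foldr (gen_act n) v f = foldr (gen_act n) w f"
  shows "word_eval (GL n) (\<rho>_gen n) v = word_eval (GL n) (\<rho>_gen n) w"
proof -
  interpret GL: group "GL n" by (rule group_GL)
  show ?thesis
    using carrier_GL[OF GL.word_eval_closed[OF \<rho>_gen_closed[OF n] assms(2)]]
      carrier_GL[OF GL.word_eval_closed[OF \<rho>_gen_closed[OF n] assms(3)]]
    by (rule mat_eq_by_coords) (simp only: \<rho>_word_coords[OF n assms(2)] \<rho>_word_coords[OF n assms(3)] assms(4))
qed

lemma virtual_rels_words:
  assumes "3 \<le> n" "(r, r') \<in> braid_rels n \<union> cyl_rels n \<union> virtual_rels n"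
  shows "r \<in> words (virtual_gens n)" "r' \<in> words (virtual_gens n)"
proof -
  have "cyl_gens n \<subseteq> virtual_gens n" by auto
  then have "(r, r') \<in> braid_rels n \<union> cyl_rels n \<Longrightarrow> r \<in> words (virtual_gens n)"
    "(r, r') \<in> braid_rels n \<union> cyl_rels n \<Longrightarrow> r' \<in> words (virtual_gens n)"
    using cyl_rels_words[OF assms(1)] words_mono by blast+
  moreover have "(r, r') \<in> virtual_rels n \<Longrightarrow> r \<in> words (virtual_gens n)"
    "(r, r') \<in> virtual_rels n \<Longrightarrow> r' \<in> words (virtual_gens n)"
    using assms(1) by (auto simp: virtual_rels_def intro!: imageI)
  ultimately show "r \<in> words (virtual_gens n)" "r' \<in> words (virtual_gens n)" using assms(2) by blast+
qed

lemma gen_act_cyl_relations: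
  assumes n: "3 \<le> n" and "(r, r') \<in> braid_rels n \<union> cyl_rels n"
  shows "foldr (gen_act n) r f = foldr (gen_act n) r' f"
proof -
  from assms(2) consider
    i where "r = [pos (\<sigma> i), pos (\<sigma> (i + 1)), pos (\<sigma> i)]"
      "r' = [pos (\<sigma> (i + 1)), pos (\<sigma> i), pos (\<sigma> (i + 1))]"
  | i j where "i + 2 \<le> j \<or> j + 2 \<le> i" "r = [pos (\<sigma> i), pos (\<sigma> j)]" "r' = [pos (\<sigma> j), pos (\<sigma> i)]"
  | i where "1 \<le> i" "i \<le> n - 2" "r = [pos \<zeta>, pos (\<sigma> (i + 1)), neg \<zeta>]" "r' = [pos (\<sigma> i)]"
  | "r = [pos \<zeta>, pos \<zeta>, pos (\<sigma> 1), neg \<zeta>, neg \<zeta>]" "r' = [pos (\<sigma> (n - 1))]"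
    unfolding braid_rels_def cyl_rels_def by blast
  then show ?thesis
  proof cases
    case 1
    then show ?thesis using L.cross_braid[of i f] by simp
  next
    case 2
    then show ?thesis using L.cross_far[of i j f] by simp
  next
    case 3
    then show ?thesis using n by (auto simp: L.cross_def fun_eq_iff)
  next
    case 4
    show ?thesis
    proof
      fix x
      consider "x = 0" | "x = n - 1" | "x = n" | "1 \<le> x" "x < n - 1" | "n < x" using n by linarith
      then show "foldr (gen_act n) r f x = foldr (gen_act n) r' f x"
        using n 4 by cases (auto simp: L.cross_def)
    qed
  qed
qed

lemma gen_act_virtual_relations:
  assumes n: "3 \<le> n" and "(r, r') \<in> virtual_rels n"
  shows "foldr (gen_act n) r f = foldr (gen_act n) r' f"
proof -
  have s: "sL * (sL_inv * y) = y" "sL_inv * (sL * y) = y" for y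
    using sL_sL_inv mult.assoc[of sL sL_inv y] mult.assoc[of sL_inv sL y]
    by (simp_all add: mult.commute)
  have linear: "sL_inv * ((1 - tL) * a + tL * b) = (1 - tL) * (sL_inv * a) + tL * (sL_inv * b)" for a b
    by (simp add: algebra_simps)
  have square: "?thesis" if "r = [pos (\<tau> i), pos (\<tau> i)]" "r' = []" for i
    using that by (auto simp: fun_eq_iff s)
  have braid: "?thesis" if "r = [pos (\<tau> i), pos (\<tau> (i + 1)), pos (\<tau> i)]"
    "r' = [pos (\<tau> (i + 1)), pos (\<tau> i), pos (\<tau> (i + 1))]" for i
    using that by (auto simp: fun_eq_iff mult.left_commute)
  have far: "?thesis" if "r = [pos (\<tau> i), pos (\<tau> j)]" "r' = [pos (\<tau> j), pos (\<tau> i)]"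
    "i + 2 \<le> j \<or> j + 2 \<le> i" for i j
    using that by (auto simp: fun_eq_iff)
  have mixed_far: "?thesis" if "r = [pos (\<sigma> i), pos (\<tau> j)]" "r' = [pos (\<tau> j), pos (\<sigma> i)]"
    "i + 2 \<le> j \<or> j + 2 \<le> i" for i j
    using that by (auto simp: fun_eq_iff L.cross_def)
  have mixed: "?thesis" if "r = [pos (\<tau> i), pos (\<tau> (i + 1)), pos (\<sigma> i)]"
    "r' = [pos (\<sigma> (i + 1)), pos (\<tau> i), pos (\<tau> (i + 1))]" for i
    using that linear by (auto simp: fun_eq_iff L.cross_def)
  have shift: "?thesis" if "r = [pos \<zeta>, pos (\<tau> (i + 1)), neg \<zeta>]" "r' = [pos (\<tau> i)]"
    "1 \<le> i" "i \<le> n - 2" for i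
    using that n by (auto simp: fun_eq_iff)
  have wrap: "?thesis" if "r = [pos \<zeta>, pos \<zeta>, pos (\<tau> 1), neg \<zeta>, neg \<zeta>]" "r' = [pos (\<tau> (n - 1))]"
  proof
    fix x
    consider "x = 0" | "x = n - 1" | "x = n" | "1 \<le> x" "x < n - 1" | "n < x" using n by linarith
    then show "foldr (gen_act n) r f x = foldr (gen_act n) r' f x"
      using n that by cases auto
  qed
  show ?thesis
    using assms(2) unfolding virtual_rels_def
    by (elim UnE CollectE exE conjE singletonE Pair_inject)
      (rule square braid far mixed_far mixed shift wrap; assumption)+
qed

lemma gen_act_relations:
  assumes "3 \<le> n" "(r, r') \<in> braid_rels n \<union> cyl_rels n \<union> virtual_rels n"
  shows "foldr (gen_act n) r f = foldr (gen_act n) r' f"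
  using assms gen_act_cyl_relations gen_act_virtual_relations by blast

lemma \<rho>_map_class:
  assumes n: "3 \<le> n" and w: "w \<in> words (virtual_gens n)"
  shows "\<rho>_map n (VCB_class n w) = word_eval (GL n) (\<rho>_gen n) w"
proof -
  interpret GL: group "GL n" by (rule group_GL)
  have 2: "2 \<le> n" using n by simp
  show ?thesis unfolding \<rho>_map_def
  proof (rule GL.pres_lift_word_class[OF \<rho>_gen_closed[OF 2] _ w])
    fix r r' assume "(r, r') \<in> braid_rels n \<union> cyl_rels n \<union> virtual_rels n"
    then show "word_eval (GL n) (\<rho>_gen n) r = word_eval (GL n) (\<rho>_gen n) r'"
      using \<rho>_word_eqI[OF 2] virtual_rels_words[OF n] gen_act_relations[OF n] by blast
  qed
qed

section \<open>A braid in the kernel of the Burau representation\<close>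

text \<open>The braids \<open>psi1\<close> and \<open>psi2\<close> are those of S. Bigelow, The Burau representation is not faithful for
  n = 5, Geometry and Topology 3 (1999).\<close>

definition psi1 :: "nat word" where
  "psi1 = [(3, False), (2, True), (1, True), (1, True), (2, True),
    (4, True), (4, True), (4, True), (3, True), (2, True)]"

definition psi2 :: "nat word" where
  "psi2 = [(4, False), (3, True), (2, True), (1, False), (1, False), (2, True), (1, True), (1, True),
    (2, True), (2, True), (1, True), (4, True), (4, True), (4, True), (4, True), (4, True)]"

text \<open>The fifth strand runs once around the other four.\<close>

definition lasso :: "nat word" where
  "lasso = [(4, True), (3, True), (2, True), (1, True), (1, True), (2, True), (3, True), (4, True)]"

definition arc_twist :: "nat word" where
  "arc_twist = word_inv psi1 @ [(4, True)] @ psi1"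

definition loop_twist :: "nat word" where
  "loop_twist = word_inv psi2 @ lasso @ psi2"

definition bigelow :: "nat word" where
  "bigelow = arc_twist @ loop_twist @ word_inv arc_twist @ word_inv loop_twist"

lemma psi_words: "psi1 \<in> words {1..4}" "psi2 \<in> words {1..4}" "lasso \<in> words {1..4}"
  by (simp_all add: psi1_def psi2_def lasso_def)

lemma twist_words: "arc_twist \<in> words {1..4}" "loop_twist \<in> words {1..4}"
  using psi_words by (simp_all add: arc_twist_def loop_twist_def)

lemma bigelow_words: "bigelow \<in> words {1..4}"
  using twist_words by (simp add: bigelow_def)

lemma rev_words: "w \<in> words X \<Longrightarrow> rev w \<in> words X"
  by (induction w) auto

context rack
begin

lemma strand_cancel [simp]: "strand (i, \<not> e) (strand (i, e) f) = f"
  by (cases e) simp_all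

lemma foldr_word_inv [simp]:
  "foldr strand (word_inv w) (foldr strand w f) = f"
proof (induction w)
  case (Cons a w)
  obtain i e where "a = (i, e)" by force
  with Cons show ?case by simp
qed simp

lemma foldr_word_inv' [simp]:
  "foldr strand w (foldr strand (word_inv w) f) = f"
proof (induction w arbitrary: f)
  case (Cons a w)
  obtain i e where "a = (i, e)" by force
  moreover have "strand (i, e) (strand (i, \<not> e) f) = f" using strand_cancel[of i "\<not> e" f] by simp
  ultimately show ?case by (simp add: Cons.IH)
qed simp

lemma strand_shift:
  "strand (m + i, e) f (m + j) = strand (i, e) (\<lambda>j. f (m + j)) j"
  "j < m + i \<Longrightarrow> strand (m + i, e) f j = f j"
  by (cases e; auto simp: cross_def uncross_def)+

lemma foldr_strand_shift:
  "foldr strand (relabel ((+) m) w) f (m + j) = foldr strand w (\<lambda>j. f (m + j)) j"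
proof (induction w arbitrary: j)
  case (Cons a w)
  obtain i e where "a = (i, e)" by force
  with Cons show ?case by (simp add: strand_shift(1))
qed simp

lemma foldr_strand_below: "j < m \<Longrightarrow> foldr strand (relabel ((+) m) w) f j = f j"
proof (induction w)
  case (Cons a w)
  obtain i e where "a = (i, e)" by force
  with Cons show ?case by (simp add: strand_shift(2))
qed simp

lemma foldr_strand_trivial_shift:
  assumes "\<And>f. foldr strand w f = f"
  shows "foldr strand (relabel ((+) m) w) f = f"
proof
  fix x
  show "foldr strand (relabel ((+) m) w) f x = f x"
  proof (cases "x < m")
    case True
    then show ?thesis by (rule foldr_strand_below)
  next
    case False
    then obtain j where "x = m + j" using le_Suc_ex not_less by blast
    then show ?thesis by (simp add: foldr_strand_shift assms)
  qed
qed

end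

fun add_poly :: "int list \<Rightarrow> int list \<Rightarrow> int list" where
  "add_poly [] q = q"
| "add_poly (a # p) [] = a # p"
| "add_poly (a # p) (b # q) = (a + b) # add_poly p q"

text \<open>The Burau action on vectors of five polynomials, given by their coefficients from the constant
  one upwards. Inverse crossings are multiplied by \<open>t\<close>, which keeps the entries polynomial.\<close>

definition poly_strand :: "nat \<times> bool \<Rightarrow> int list list \<Rightarrow> int list list" where
  "poly_strand l ps = (let i = fst l; a = ps ! (i - 1); b = ps ! i in
     if snd l then ps[i - 1 := add_poly a (0 # add_poly b (map uminus a)), i := a]
     else (map ((#) 0) ps)[i - 1 := 0 # b, i := add_poly a (add_poly (map uminus b) (0 # b))])"

lemma length_poly_strand [simp]: "length (poly_strand l ps) = length ps"
  by (simp add: poly_strand_def Let_def)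

lemma poly_strand_eval:
  "poly_strand (1, True) [a, b, c, d, e] = [add_poly a (0 # add_poly b (map uminus a)), a, c, d, e]"
  "poly_strand (2, True) [a, b, c, d, e] = [a, add_poly b (0 # add_poly c (map uminus b)), b, d, e]"
  "poly_strand (3, True) [a, b, c, d, e] = [a, b, add_poly c (0 # add_poly d (map uminus c)), c, e]"
  "poly_strand (4, True) [a, b, c, d, e] = [a, b, c, add_poly d (0 # add_poly e (map uminus d)), d]"
  "poly_strand (1, False) [a, b, c, d, e] =
    [0 # b, add_poly a (add_poly (map uminus b) (0 # b)), 0 # c, 0 # d, 0 # e]"
  "poly_strand (2, False) [a, b, c, d, e] =
    [0 # a, 0 # c, add_poly b (add_poly (map uminus c) (0 # c)), 0 # d, 0 # e]"
  "poly_strand (3, False) [a, b, c, d, e] =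
    [0 # a, 0 # b, 0 # d, add_poly c (add_poly (map uminus d) (0 # d)), 0 # e]"
  "poly_strand (4, False) [a, b, c, d, e] =
    [0 # a, 0 # b, 0 # c, 0 # e, add_poly d (add_poly (map uminus e) (0 # e))]"
  by (simp_all add: poly_strand_def numeral_eq_Suc)

definition poly_dart :: "int list list" where
  "poly_dart = [[], [], [], [0, 1], [-1]]"

text \<open>Only the vanishing of the fifth coordinate enters the argument. Geometrically it says that the
  weighted count of the intersections of an arc and a curve is zero, although they cannot be made
  disjoint.\<close>

lemma intersection_vanish:
  "list_all (\<lambda>a. a = 0) (foldr poly_strand (psi2 @ word_inv psi1) poly_dart ! 4)"
  "list_all (\<lambda>a. a = 0) (foldr poly_strand (rev (psi1 @ word_inv psi2)) poly_dart ! 4)"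
  by (simp_all add: poly_strand_eval[simplified] psi1_def psi2_def poly_dart_def)

context alexander
begin

primrec poly_val :: "int list \<Rightarrow> 'a" where
  "poly_val [] = 0"
| "poly_val (a # p) = of_int a + t * poly_val p"

lemma poly_val_add [simp]: "poly_val (add_poly p q) = poly_val p + poly_val q"
  by (induction p q rule: add_poly.induct) (simp_all add: algebra_simps)

lemma poly_val_uminus [simp]: "poly_val (map uminus p) = - poly_val p"
  by (induction p) (simp_all add: algebra_simps)

lemma poly_val_zero: "list_all (\<lambda>a. a = 0) p \<Longrightarrow> poly_val p = 0"
  by (induction p) simp_all

lemma t_cancel: "t ^ k * x = 0 \<Longrightarrow> x = 0"
proof -
  assume "t ^ k * x = 0"
  then have "(t * u) ^ k * x = 0"
    by (metis mult.assoc mult.commute mult_zero_right power_mult_distrib)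
  then show "x = 0" by (simp add: t_u)
qed

text \<open>The power of \<open>t\<close> accounts for the scaled inverse crossings.\<close>

definition represents :: "int list list \<Rightarrow> (nat \<Rightarrow> 'a) \<Rightarrow> bool" where
  "represents ps f \<longleftrightarrow> length ps = 5 \<and> (\<exists>k. \<forall>j<5. poly_val (ps ! j) = t ^ k * f (Suc j))"

lemma represents_strand:
  assumes "represents ps f" "i \<in> {1..4}"
  shows "represents (poly_strand (i, e) ps) (strand (i, e) f)"
proof -
  obtain k where len: "length ps = 5" and k: "\<And>j. j < 5 \<Longrightarrow> poly_val (ps ! j) = t ^ k * f (Suc j)"
    using assms(1) unfolding represents_def by blast
  obtain m where m: "i = Suc m" "m < 4" using assms(2) by (cases i) auto
  note vals = k[of m] k[of "Suc m"]
  show ?thesis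
  proof (cases e)
    case True
    have "poly_val (poly_strand (i, e) ps ! j) = t ^ k * strand (i, e) f (Suc j)" if "j < 5" for j
      using True m len that k[OF that] vals
      by (auto simp: poly_strand_def Let_def cross_def nth_list_update; simp add: algebra_simps)
    then show ?thesis unfolding represents_def using len by auto
  next
    case False
    have u: "t * t ^ k * (u * x) = t ^ k * x" for x
      using t_u by (metis mult.assoc mult.commute mult_1)
    have "poly_val (poly_strand (i, e) ps ! j) = t ^ Suc k * strand (i, e) f (Suc j)" if "j < 5" for j
      using False m len that k[OF that] vals
      by (auto simp: poly_strand_def Let_def uncross_def nth_list_update u; simp add: algebra_simps)
    then show ?thesis unfolding represents_def using len by (metis length_poly_strand)
  qed
qed

lemma represents_word:
  assumes "represents ps f" "w \<in> words {1..4}"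
  shows "represents (foldr poly_strand w ps) (foldr strand w f)"
  using assms(2)
proof (induction w)
  case (Cons a w)
  then show ?case by (cases a) (simp add: represents_strand)
qed (simp add: assms(1))

text \<open>The direction of the transvection \<open>cross 4\<close>, see \<open>cross_4\<close>.\<close>

definition dart :: "nat \<Rightarrow> 'a" where
  "dart j = (if j = 4 then t else if j = 5 then - 1 else 0)"

lemma represents_dart: "represents poly_dart dart"
  unfolding represents_def
  by (intro conjI exI[of _ 0]) (auto simp: poly_dart_def dart_def less_Suc_eq numeral_eq_Suc)

lemma foldr_dart_5:
  assumes "w \<in> words {1..4}" "list_all (\<lambda>a. a = 0) (foldr poly_strand w poly_dart ! 4)"
  shows "foldr strand w dart 5 = 0"
proof -
  obtain k where "poly_val (foldr poly_strand w poly_dart ! 4) = t ^ k * foldr strand w dart 5"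
    using represents_word[OF represents_dart assms(1)] unfolding represents_def by fastforce
  then show ?thesis using poly_val_zero[OF assms(2)] t_cancel by simp
qed

lemma strand_linear:
  "strand (i, e) (\<lambda>j. f j + c * g j) = (\<lambda>j. strand (i, e) f j + c * strand (i, e) g j)"
  by (cases e; auto simp: cross_def uncross_def fun_eq_iff; simp add: algebra_simps)

lemma foldr_linear:
  "foldr strand w (\<lambda>j. f j + c * g j) = (\<lambda>j. foldr strand w f j + c * foldr strand w g j)"
proof (induction w)
  case (Cons a w)
  then show ?case by (cases a) (simp add: strand_linear)
qed simp

text \<open>Crossings are self-adjoint for this form, so the adjoint of a word is its reverse. As
  all braids fix the constant vector (\<open>foldr_one\<close>), they preserve orthogonality to it.\<close>

definition pairing :: "(nat \<Rightarrow> 'a) \<Rightarrow> (nat \<Rightarrow> 'a) \<Rightarrow> 'a" where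
  "pairing f g = (\<Sum>j\<in>{1, 2, 3, 4, 5}. t ^ j * f j * g j)"

lemma strand_self_adjoint:
  assumes "i \<in> {1..4}"
  shows "pairing (strand (i, e) f) g = pairing f (strand (i, e) g)"
proof -
  have i: "i \<in> {1, 2, 3, 4}" using assms by auto
  have cross: "pairing (cross i f) g = pairing f (cross i g)" for f g
    using i by (auto simp: pairing_def cross_def numeral_eq_Suc; simp add: algebra_simps)
  show ?thesis
  proof (cases e)
    case False
    have "pairing (uncross i f) g = pairing (uncross i f) (cross i (uncross i g))" by simp
    also have "\<dots> = pairing f (uncross i g)" unfolding cross[symmetric] by simp
    finally show ?thesis using False by simp
  qed (simp add: cross)
qed

lemma foldr_adjoint:
  assumes "w \<in> words {1..4}"
  shows "pairing (foldr strand w f) g = pairing f (foldr strand (rev w) g)"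
  using assms
proof (induction w arbitrary: g)
  case (Cons a w)
  then show ?case by (cases a) (simp add: strand_self_adjoint)
qed simp

lemma foldr_one: "foldr strand w (\<lambda>_. 1) = (\<lambda>_. 1)"
proof (induction w)
  case (Cons a w)
  have "u * t = 1" using t_u by (simp add: mult.commute)
  then have "cross i (\<lambda>_. 1) = (\<lambda>_. 1)" "uncross i (\<lambda>_. 1) = (\<lambda>_. 1)" for i
    by (auto simp: cross_def uncross_def fun_eq_iff)
  then show ?case using Cons by (cases a; cases "snd a") simp_all
qed simp

lemma foldr_outside:
  assumes "w \<in> words {1..4}" "j \<notin> {1..5}"
  shows "foldr strand w f j = f j"
  using assms(1)
proof (induction w)
  case (Cons a w)
  then show ?case using assms(2)
    by (cases a; cases "snd a") (auto simp: cross_def uncross_def)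
qed simp

text \<open>On five coordinates the two conditions cut out a space of dimension three, on which the loop
  around the other four strands acts as a scalar; orthogonality to the constant vector expresses the
  first coordinate by the second, third and fourth.\<close>

lemma lasso_eigenvector:
  assumes "\<And>j. j \<notin> {1..5} \<Longrightarrow> f j = 0" "f 5 = 0" "pairing (\<lambda>_. 1) f = 0"
  shows "foldr strand lasso f = (\<lambda>j. t * f j)"
proof -
  \<comment> \<open>The exponents in \<open>pairing\<close> start at 1; one factor \<open>t\<close> is removed.\<close>
  have "u * pairing (\<lambda>_. 1) f = (t * u) * (f 1 + t * f 2 + t * t * f 3 + t * t * t * f 4)"
    by (simp add: pairing_def assms(2) algebra_simps power_numeral_reduce)
  then have "f 1 = - (t * f 2 + t * t * f 3 + t * t * t * f 4)"
    using assms(3) t_u by (simp add: algebra_simps eq_neg_iff_add_eq_0)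
  then have f1: "f (Suc 0) = - (t * f (Suc (Suc 0)) + t * t * f (Suc (Suc (Suc 0))) +
      t * t * t * f (Suc (Suc (Suc (Suc 0)))))"
    by (simp add: numeral_eq_Suc)
  show ?thesis
  proof
    fix j :: nat
    consider "j = 0" | "j = 1" | "j = 2" | "j = 3" | "j = 4" | "j = 5" | "5 < j" by linarith
    then show "foldr strand lasso f j = t * f j"
      using assms(1)[of j] assms(2)
      by cases (auto simp: lasso_def cross_def f1 numeral_eq_Suc; simp add: algebra_simps)+
  qed
qed

lemma lasso_dart:
  assumes "w \<in> words {1..4}" "foldr strand w dart 5 = 0"
  shows "foldr strand lasso (foldr strand w dart) = (\<lambda>j. t * foldr strand w dart j)"
proof (rule lasso_eigenvector)
  show "foldr strand w dart j = 0" if "j \<notin> {1..5}" for j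
    using foldr_outside[OF assms(1) that] that by (auto simp: dart_def)
  have "pairing (\<lambda>_. 1) (foldr strand w dart) = pairing (foldr strand (rev w) (\<lambda>_. 1)) dart"
    using foldr_adjoint[of "rev w"] rev_words[OF assms(1)] by simp
  then show "pairing (\<lambda>_. 1) (foldr strand w dart) = 0"
    unfolding foldr_one by (simp add: pairing_def dart_def power_numeral_reduce)
qed (rule assms(2))

lemma cross_4: "cross 4 f = (\<lambda>j. f j + (- (u ^ 5) * pairing dart f) * dart j)"
proof -
  have u5: "u ^ 5 * (t ^ 5 * x) = x" for x
    using t_u by (metis mult.assoc mult.commute mult_1 power_mult_distrib power_one)
  have "pairing dart f = - (t ^ 5 * (f 5 - f 4))"
    by (simp add: pairing_def dart_def algebra_simps power_numeral_reduce)
  then have "- (u ^ 5) * pairing dart f = f 5 - f 4" using u5[of "f 5 - f 4"] by simp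
  then show ?thesis by (auto simp: cross_def dart_def fun_eq_iff; simp add: algebra_simps)
qed

text \<open>Conjugation by \<open>psi2\<close> turns \<open>loop_twist\<close> into \<open>lasso\<close> and \<open>arc_twist\<close> into the transvection \<open>a\<close> with
  direction \<open>w\<close> and functional \<open>pairing w'\<close>. Both \<open>w\<close> and \<open>w'\<close> are eigenvectors of the self-adjoint
  operator \<open>lasso\<close> for the same eigenvalue \<open>t\<close>, hence \<open>a\<close> and \<open>lasso\<close> commute.\<close>

lemma twists_commute:
  "foldr strand loop_twist (foldr strand arc_twist f) = foldr strand arc_twist (foldr strand loop_twist f)"
proof -
  define w where "w = foldr strand (psi2 @ word_inv psi1) dart"
  define w' where "w' = foldr strand (rev (psi1 @ word_inv psi2)) dart"
  define c where "c = - (u ^ 5)"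
  define a where "a = (\<lambda>g j. g j + (c * pairing w' g) * w j)"
  have words: "psi2 @ word_inv psi1 \<in> words {1..4}" "rev (psi1 @ word_inv psi2) \<in> words {1..4}"
    using psi_words by (auto intro: rev_words simp del: rev_append)
  have lasso_w: "foldr strand lasso w = (\<lambda>j. t * w j)"
    unfolding w_def by (rule lasso_dart[OF words(1) foldr_dart_5[OF words(1) intersection_vanish(1)]])
  have lasso_w': "foldr strand lasso w' = (\<lambda>j. t * w' j)"
    unfolding w'_def by (rule lasso_dart[OF words(2) foldr_dart_5[OF words(2) intersection_vanish(2)]])
  have conj: "foldr strand psi2 (foldr strand arc_twist g) = a (foldr strand psi2 g)" for g
  proof -
    have "pairing w' (foldr strand psi2 g) = pairing dart (foldr strand psi1 g)"
      using foldr_adjoint[OF words(2)] by (simp add: w'_def)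
    moreover have "foldr strand psi2 (foldr strand arc_twist g) =
        foldr strand (psi2 @ word_inv psi1) (\<lambda>j. foldr strand psi1 g j +
          (c * pairing dart (foldr strand psi1 g)) * dart j)"
      by (simp add: arc_twist_def c_def cross_4)
    ultimately show ?thesis unfolding foldr_linear a_def w_def by simp
  qed
  have "pairing w' (foldr strand lasso g) = t * pairing w' g" for g
  proof -
    have "pairing w' (foldr strand lasso g) = pairing (foldr strand lasso w') g"
      using foldr_adjoint[OF psi_words(3), of w' g] by (simp add: lasso_def)
    also have "\<dots> = t * pairing w' g" unfolding lasso_w' pairing_def by (simp add: algebra_simps)
    finally show ?thesis .
  qed
  then have comm: "foldr strand lasso (a g) = a (foldr strand lasso g)" for g
    unfolding a_def foldr_linear lasso_w by (simp add: algebra_simps)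
  have "foldr strand psi2 (foldr strand loop_twist (foldr strand arc_twist f)) =
      foldr strand lasso (a (foldr strand psi2 f))"
    by (simp add: loop_twist_def conj)
  also have "\<dots> = foldr strand psi2 (foldr strand arc_twist (foldr strand loop_twist f))"
    by (simp add: loop_twist_def conj comm)
  finally show ?thesis by (metis foldr_word_inv)
qed

theorem foldr_bigelow: "foldr strand bigelow f = f"
proof -
  let ?g = "foldr strand (word_inv arc_twist) (foldr strand (word_inv loop_twist) f)"
  have "foldr strand bigelow f = foldr strand arc_twist (foldr strand loop_twist ?g)"
    by (simp add: bigelow_def)
  also have "\<dots> = f" by (simp flip: twists_commute)
  finally show ?thesis .
qed

end

section \<open>Detecting the braid by a rack colouring\<close>

context rack
begin

text \<open>The action on finitely many colours, in a form that simplification can evaluate.\<close>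

definition list_strand :: "nat \<times> bool \<Rightarrow> 'a list \<Rightarrow> 'a list" where
  "list_strand l xs = (let i = fst l; a = xs ! (i - 1); b = xs ! i in
     if snd l then xs[i - 1 := op a b, i := a] else xs[i - 1 := b, i := co b a])"

lemma length_list_strand [simp]: "length (list_strand l xs) = length xs"
  by (simp add: list_strand_def Let_def)

lemma strand_list_strand:
  assumes "1 \<le> i" "i < length xs" "\<And>j. j < length xs \<Longrightarrow> f (Suc j) = xs ! j" "j < length xs"
  shows "strand (i, e) f (Suc j) = list_strand (i, e) xs ! j"
proof -
  obtain m where "i = Suc m" using assms(1) by (cases i) auto
  then show ?thesis using assms
    by (cases e) (auto simp: list_strand_def Let_def cross_def uncross_def nth_list_update)
qed

lemma length_foldr_list_strand [simp]: "length (foldr list_strand w xs) = length xs"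
  by (induction w) simp_all

lemma foldr_list_strand:
  assumes "w \<in> words {1..<length xs}" "\<And>j. j < length xs \<Longrightarrow> f (Suc j) = xs ! j" "j < length xs"
  shows "foldr strand w f (Suc j) = foldr list_strand w xs ! j"
  using assms(1,3)
proof (induction w arbitrary: j)
  case (Cons a w)
  obtain i e where a: "a = (i, e)" by force
  show ?case using Cons strand_list_strand[of i "foldr list_strand w xs" "foldr strand w f" j e]
    by (simp add: a)
qed (simp add: assms(2))

definition braid_act :: "gen \<times> bool \<Rightarrow> (nat \<Rightarrow> 'a) \<Rightarrow> nat \<Rightarrow> 'a" where
  "braid_act l f = (case fst l of \<sigma> i \<Rightarrow> strand (i, snd l) f | _ \<Rightarrow> f)"

lemma foldr_braid_act_relabel:
  "foldr braid_act (relabel (\<lambda>i. \<sigma> (h i)) w) f = foldr strand (relabel h w) f"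
proof (induction w)
  case (Cons a w)
  then show ?case by (cases a) (simp add: braid_act_def)
qed simp

lemma braid_act_pres_rel:
  assumes "(v, w) \<in> pres_rel (braid_gens m) (braid_rels m)"
  shows "foldr braid_act v f = foldr braid_act w f"
proof (rule foldr_pres_rel[OF _ _ assms])
  show "braid_act (x, e) (braid_act (x, \<not> e) s) = s" for x e s
    by (cases x; cases e) (simp_all add: braid_act_def)
  fix r r' s assume "(r, r') \<in> braid_rels m"
  then consider i where "r = [pos (\<sigma> i), pos (\<sigma> (i + 1)), pos (\<sigma> i)]"
      "r' = [pos (\<sigma> (i + 1)), pos (\<sigma> i), pos (\<sigma> (i + 1))]"
  | i j where "i + 2 \<le> j \<or> j + 2 \<le> i" "r = [pos (\<sigma> i), pos (\<sigma> j)]" "r' = [pos (\<sigma> j), pos (\<sigma> i)]"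
    unfolding braid_rels_def by blast
  then show "foldr braid_act r s = foldr braid_act r' s"
  proof cases
    case 1
    then show ?thesis using cross_braid[of i s] by (simp add: braid_act_def)
  next
    case 2
    then show ?thesis using cross_far[of i j s] by (simp add: braid_act_def)
  qed
qed

end

text \<open>The pair \<open>(a, b)\<close> stands for the transposition of \<open>a\<close> and \<open>b\<close>, and the operation is conjugation.
  Conjugation by a transposition is an involution, so it also serves as the inverse operation.\<close>

definition swap_by :: "nat \<times> nat \<Rightarrow> nat \<times> nat \<Rightarrow> nat \<times> nat" where
  "swap_by p q = map_prod (transpose (fst p) (snd p)) (transpose (fst p) (snd p)) q"

lemma transpose_transpose:
  "transpose a b (transpose c d x) =
    transpose (transpose a b c) (transpose a b d) (transpose a b x)"
proof (cases "x = c \<or> x = d")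
  case False
  then have "transpose a b x \<noteq> transpose a b c" "transpose a b x \<noteq> transpose a b d"
    by (auto dest: injD[OF inj_transpose])
  then show ?thesis using False by simp
qed auto

interpretation T: rack swap_by swap_by
proof
  fix p q r
  show "swap_by p (swap_by p q) = q"
    by (simp add: swap_by_def prod_eq_iff)
  show "swap_by p (swap_by q r) = swap_by (swap_by p q) (swap_by p r)"
    using transpose_transpose[of "fst p" "snd p" "fst q" "snd q"]
    by (simp add: swap_by_def prod_eq_iff)
qed

lemma list_strand_eval:
  "T.list_strand (1, True) [a, b, c, d, e] = [swap_by a b, a, c, d, e]"
  "T.list_strand (2, True) [a, b, c, d, e] = [a, swap_by b c, b, d, e]"
  "T.list_strand (3, True) [a, b, c, d, e] = [a, b, swap_by c d, c, e]"
  "T.list_strand (4, True) [a, b, c, d, e] = [a, b, c, swap_by d e, d]"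
  "T.list_strand (1, False) [a, b, c, d, e] = [b, swap_by b a, c, d, e]"
  "T.list_strand (2, False) [a, b, c, d, e] = [a, c, swap_by c b, d, e]"
  "T.list_strand (3, False) [a, b, c, d, e] = [a, b, d, swap_by d c, e]"
  "T.list_strand (4, False) [a, b, c, d, e] = [a, b, c, e, swap_by e d]"
  by (simp_all add: T.list_strand_def numeral_eq_Suc)

section \<open>The kernel is not trivial\<close>

text \<open>In a group where the letters are involutions the palindrome \<open>lasso\<close> collapses, so the commutator
  has a trivial factor. This gives purity.\<close>

lemma (in group) word_eval_bigelow:
  assumes "\<And>i. i \<in> {1..4} \<Longrightarrow> f i \<in> carrier G" "\<And>i. i \<in> {1..4} \<Longrightarrow> f i \<otimes> f i = \<one>"
  shows "word_eval G f bigelow = \<one>"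
proof -
  have f: "f ` {1..4} \<subseteq> carrier G" using assms(1) by blast
  have square: "f i \<otimes> (f i \<otimes> x) = x" if "i \<in> {1..4}" "x \<in> carrier G" for i x
    using assms[OF that(1)] that(2) by (simp flip: m_assoc)
  have "word_eval G f lasso = \<one>"
    using assms[of 1] assms[of 2] assms[of 3] assms[of 4] square[of 1] square[of 2] square[of 3] square[of 4]
    by (simp add: lasso_def)
  then have "word_eval G f loop_twist = \<one>"
    using psi_words by (simp add: loop_twist_def word_eval_append[OF f] word_eval_word_inv[OF f]
        word_eval_closed[OF f] m_assoc)
  then show ?thesis
    using twist_words by (simp add: bigelow_def word_eval_append[OF f] word_eval_word_inv[OF f]
        word_eval_closed[OF f])
qed

lemma strand_perm_pure:
  assumes "h ` {1..4} \<subseteq> {1..m - 1}"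
  shows "word_eval (sym_group m) (strand_perm m) (relabel (\<lambda>i. \<sigma> (h i)) bigelow) = \<one>\<^bsub>sym_group m\<^esub>"
proof -
  interpret S: group "sym_group m" by (rule sym_group_is_group)
  show ?thesis
    unfolding S.word_eval_relabel
  proof (rule S.word_eval_bigelow)
    fix i :: nat assume i: "i \<in> {1..4}"
    then have "h i \<in> {1..m - 1}" using assms by blast
    then show "(strand_perm m \<circ> (\<lambda>i. \<sigma> (h i))) i \<in> carrier (sym_group m)"
      unfolding comp_def by (rule strand_perm_\<sigma>)
    show "(strand_perm m \<circ> (\<lambda>i. \<sigma> (h i))) i \<otimes>\<^bsub>sym_group m\<^esub> (strand_perm m \<circ> (\<lambda>i. \<sigma> (h i))) i =
        \<one>\<^bsub>sym_group m\<^esub>"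
      by (simp add: sym_group_mult sym_group_one fun_eq_iff)
  qed
qed

text \<open>All letters stay to the left of position \<open>k\<close>, so the distinguished strand does not move. Its
  left neighbours are numbered by \<open>p\<^sub>k\<close> in the opposite order.\<close>

lemma p_word_flip:
  assumes "w \<in> words {1..4}" "6 \<le> k"
  shows "p_word n k (relabel (\<lambda>i. \<sigma> (5 - i)) w) = relabel (\<lambda>i. \<sigma> (k - 6 + i)) w"
  using assms(1)
proof (induction w)
  case (Cons a w)
  obtain i e where a: "a = (i, e)" by force
  have i: "1 \<le> i" "i \<le> 4" using Cons.prems a by auto
  have "p_letter n k (5 - i) e = [(\<sigma> (k - 6 + i), e)]" "p_pos k (5 - i) = k"
    using i assms(2) by (auto simp: p_letter_def p_pos_def)
  then show ?case using Cons by (simp add: a)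
qed simp

lemma gen_act_relabel:
  "foldr (gen_act n) (relabel (\<lambda>i. \<sigma> (h i)) w) f = foldr L.strand (relabel h w) f"
proof (induction w)
  case (Cons a w)
  then show ?case by (cases a) simp
qed simp

text \<open>Five colours that generate the symmetric group on four letters. The second one becomes the
  disjoint transposition.\<close>

lemma bigelow_moves:
  "foldr T.list_strand (relabel (\<lambda>i. 5 - i) bigelow) [(0, 1), (0, 1), (0, 1), (0, 2), (0, 3)] ! 1 \<noteq> (0, 1)"
  by (simp add: list_strand_eval[simplified] bigelow_def arc_twist_def loop_twist_def psi1_def psi2_def
      lasso_def swap_by_def transpose_def)

theorem theorem1:
  fixes n k :: nat and d :: int
  assumes "6 \<le> k" and "k \<le> n + 1"
  shows "\<exists>\<beta> \<in> kernel (PB (n + 1)) (GL n) (\<rho>_map n \<circ> f_map n d \<circ> p_map n k). \<beta> \<noteq> \<one>\<^bsub>PB (n + 1)\<^esub>"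
proof -
  \<comment> \<open>\<open>v\<close> runs on positions 1 to 5; its image \<open>w\<close> on the positions \<open>k - 5\<close> to \<open>k - 1\<close>, in the order
    in which the Burau computation was made.\<close>
  define v where "v = relabel (\<lambda>i. \<sigma> (5 - i)) bigelow"
  define w where "w = relabel (\<lambda>i. \<sigma> (k - 6 + i)) bigelow"
  define \<beta> where "\<beta> = B_class (n + 1) v"
  have n: "3 \<le> n" and n2: "2 \<le> n" and k: "k \<in> {1..n + 1}" using assms by auto
  have v: "v \<in> words (braid_gens (n + 1))"
    unfolding v_def using assms by (intro relabel_words[OF bigelow_words]) (auto intro!: imageI)
  have w: "w \<in> words (\<sigma> ` {1..n - 1})"
    unfolding w_def using assms by (intro relabel_words[OF bigelow_words]) (auto intro!: imageI)
  have w_cyl: "w \<in> words (cyl_gens n)" by (rule words_mono[OF w]) blast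
  have w_virtual: "w \<in> words (virtual_gens n)" by (rule words_mono[OF w]) blast
  interpret S: group "sym_group n" by (rule sym_group_is_group)
  interpret S': group "sym_group (n + 1)" by (rule sym_group_is_group)
  interpret GL: group "GL n" by (rule group_GL)
  have "pres_lift (sym_group (n + 1)) (strand_perm (n + 1)) \<beta> =
      word_eval (sym_group (n + 1)) (strand_perm (n + 1)) v"
    unfolding \<beta>_def by (rule S'.pres_lift_word_class[OF strand_perm_braid strand_perm_braid_rels v])
  also have "\<dots> = \<one>\<^bsub>sym_group (n + 1)\<^esub>"
    unfolding v_def by (rule strand_perm_pure) (use assms in auto)
  finally have \<beta>: "\<beta> \<in> carrier (PB (n + 1))"
    using word_class_closed[OF v] by (simp add: PB_def kernel_def Braid_def \<beta>_def)
  have "pres_lift (sym_group n) (strand_perm n) (CB_class n w) =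
      word_eval (sym_group n) (strand_perm n) w"
    by (rule S.pres_lift_word_class[OF strand_perm_cyl[OF n2] strand_perm_cyl_rels[OF n] w_cyl])
  also have "\<dots> = \<one>\<^bsub>sym_group n\<^esub>"
    unfolding w_def by (rule strand_perm_pure) (use assms in auto)
  finally have CPB: "CB_class n w \<in> carrier (CPB n)"
    using word_class_closed[OF w_cyl] by (simp add: CPB_def kernel_def CB_def)
  have "p_map n k \<beta> = CB_class n w"
    using p_map_class[OF n k v] \<beta> p_word_flip[OF bigelow_words assms(1)]
    by (simp add: \<beta>_def v_def w_def)
  moreover have "f_map n d (CB_class n w) = VCB_class n w"
    by (rule f_map_class[OF n w CPB])
  moreover have "\<rho>_map n (VCB_class n w) = \<one>\<^bsub>GL n\<^esub>"
  proof -
    have "word_eval (GL n) (\<rho>_gen n) w = word_eval (GL n) (\<rho>_gen n) []"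
      using L.foldr_strand_trivial_shift[OF L.foldr_bigelow]
      by (intro \<rho>_word_eqI[OF n2 w_virtual]) (simp_all add: w_def gen_act_relabel)
    then show ?thesis unfolding \<rho>_map_class[OF n w_virtual] by simp
  qed
  ultimately have kernel: "\<beta> \<in> kernel (PB (n + 1)) (GL n) (\<rho>_map n \<circ> f_map n d \<circ> p_map n k)"
    using \<beta> by (simp add: kernel_def)
  have "\<beta> \<noteq> \<one>\<^bsub>PB (n + 1)\<^esub>"
  proof
    assume "\<beta> = \<one>\<^bsub>PB (n + 1)\<^esub>"
    then have "B_class (n + 1) v = B_class (n + 1) []"
      by (simp add: \<beta>_def PB_def Braid_def one_pres_group)
    then have rel: "(v, []) \<in> pres_rel (braid_gens (n + 1)) (braid_rels (n + 1))"
      using word_class_eq_iff[OF v Nil_words] by blast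
    \<comment> \<open>The colouring of \<open>bigelow_moves\<close>; positions start at 1, list indices at 0.\<close>
    define xs :: "(nat \<times> nat) list" where "xs = [(0, 1), (0, 1), (0, 1), (0, 2), (0, 3)]"
    define f where "f = (\<lambda>j. xs ! (j - 1))"
    have "relabel (\<lambda>i. 5 - i) bigelow \<in> words {1..<length xs}"
      by (rule relabel_words[OF bigelow_words]) (auto simp: xs_def)
    then have "foldr T.strand (relabel (\<lambda>i. 5 - i) bigelow) f (Suc 1) =
        foldr T.list_strand (relabel (\<lambda>i. 5 - i) bigelow) xs ! 1"
      by (rule T.foldr_list_strand) (simp_all add: f_def xs_def)
    also have "foldr T.strand (relabel (\<lambda>i. 5 - i) bigelow) f = f"
      using T.braid_act_pres_rel[OF rel, of f] unfolding v_def T.foldr_braid_act_relabel by simp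
    finally show False using bigelow_moves by (simp add: f_def xs_def)
  qed
  with kernel show ?thesis by blast
qed

end
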